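(* Let $F(x)=\mathbb{E}[F(x;\xi)]$ satisfy the basic assumptions (i)–(iv) and the weak linear regularity property with constants $\sigma_{F,\mu}$ and $\beta$ (all stated in the context). Let $x^0\in\mathbb{R}^n$, let $\{\mu_k\}_{k\ge 0}$ be a nonincreasing sequence of positive stepsizes, and let $\{x^k\}_{k\ge 0}$ be the sequence generated by the stochastic proximal point (SPP) algorithm with these data. Then for every $k\ge 0$, $$\mathbb{E}\left[\mathrm{dist}_{X^*}^2(x^{k+1})\right]\le \left[\prod_{i=0}^k (1-\mu_i\sigma_{F,\mu_0})\right]\mathrm{dist}_{X^*}^2(x^0)+(\mathcal{S}_F^*+2\beta)\sum_{i=0}^k\left[\prod_{j=i+1}^k(1-\mu_j\sigma_{F,\mu_0})\right]\mu_i^2,$$ where empty products equal $1$.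
   Context: Setting. $\xi$ is a random variable with probability space $(\Omega,\mathbb{P})$. For each $\xi$, $F(\cdot;\xi):\mathbb{R}^n\to(-\infty,+\infty]$ is proper, convex and lower semicontinuous. $F(x)=\mathbb{E}[F(x;\xi)]$, $F^*=\min_{x\in\mathbb{R}^n}F(x)$, $X^*=\arg\min F$. $\|\cdot\|$ is the Euclidean norm and $\mathrm{dist}_X(x)=\min_{z\in X}\|x-z\|$. Moreau envelope and prox. For $\mu>0$: $F_\mu(x;\xi)=\min_{z}F(z;\xi)+\frac{1}{2\mu}\|z-x\|^2$, $z_\mu(x;\xi)=\arg\min_z F(z;\xi)+\frac{1}{2\mu}\|z-x\|^2$, $F_\mu(x)=\mathbb{E}[F_\mu(x;\xi)]$, $F_\mu^*=\min_x F_\mu(x)$. Basic assumptions. (i) $X^*\neq\emptyset$. (ii) There is a subgradient mapping $g_F:\mathbb{R}^n\times\Omega\to\mathbb{R}^n$ with $g_F(x;\xi)\in\partial F(x;\xi)$ for all $\xi\in\Omega$ and $\mathbb{E}[g_F(x;\xi)]\in\partial F(x)$. (iii) There exists $\mathcal{S}_F^*\ge 0$ such that $\mathbb{E}[\|g_F(x^*;\xi)\|^2]\le\mathcal{S}_F^*<\infty$ for all $x^*\in X^*$. (iv) For any $x^*\in X^*$ and any $g_F(x^* )\in\partial F(x^* )$ there exist bounded subgradients $g_F(x^*;\xi)\in\partial F(x^*;\xi)$ such that $\mathbb{E}[g_F(x^*;\xi)]=g_F(x^* )$ and $\mathbb{E}[\|g_F(x^*;\xi)\|^2]<\mathcal{S}_F^*$;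 moreover the subgradients at $x^*$ are taken such that $g_F(x^* )=\mathbb{E}[g_F(x^*;\xi)]=0$. Weak linear regularity. There exist constants $\sigma_{F,\mu}>0$ and $\beta\ge 0$ such that for any $\mu>0$, $$\frac{\sigma_{F,\mu}}{2}\mathrm{dist}_{X^*}^2(x)\le F_\mu(x)-F_\mu^*+\mu\beta\qquad\forall x\in\mathbb{R}^n,$$ and moreover the mapping $\mu\mapsto\sigma_{F,\mu}$ is nonincreasing. SPP algorithm. Given $x^0$ and $\{\mu_k\}_{k\ge0}$, at each step $k$ choose $\xi_k\in\Omega$ randomly according to $\mathbb{P}$ (independently of the past) and set $x^{k+1}=z_{\mu_k}(x^k;\xi_k)$.
   Formalization: If X* is all of R^n, it is additionally assumed that μ_0 σ_{F,μ_0} ≤ 1; otherwise the claim can fail (F=0, S=1, β=0, σ=10, μ_k=1, k=1 gives 0 ≤ -8). If X* is not R^n, this bound is proved, not assumed. *)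

theory Defs
  imports "HOL-Probability.Probability"
begin

section \<open>Extended real valued functions\<close>

definition epi :: "('a \<Rightarrow> ereal) \<Rightarrow> ('a \<times> real) set" where
  "epi f = {(x, t). f x \<le> ereal t}"

definition proper_fun :: "('a \<Rightarrow> ereal) \<Rightarrow> bool" where
  "proper_fun f \<longleftrightarrow> (\<forall>x. f x \<noteq> -\<infinity>) \<and> (\<exists>x. f x \<noteq> \<infinity>)"

definition convex_fun :: "('a::real_vector \<Rightarrow> ereal) \<Rightarrow> bool" where
  "convex_fun f \<longleftrightarrow>
     (\<forall>x y. \<forall>u\<in>{0<..<1::real}.
        f (u *\<^sub>R x + (1 - u) *\<^sub>R y) \<le> ereal u * f x + ereal (1 - u) * f y)"

definition lower_semicontinuous :: "('a::topological_space \<Rightarrow> ereal) \<Rightarrow> bool" where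
  "lower_semicontinuous f \<longleftrightarrow> (\<forall>x. f x \<le> Liminf (at x) f)"

definition subdifferential :: "('a::real_inner \<Rightarrow> ereal) \<Rightarrow> 'a \<Rightarrow> 'a set" where
  "subdifferential f x =
     {v. \<bar>f x\<bar> \<noteq> \<infinity> \<and> (\<forall>y. f y \<ge> f x + ereal (v \<bullet> (y - x)))}"

text \<open>The minimum is required to be a real number: a function that is constantly
  \<open>\<infinity>\<close> has no minimizers.\<close>

definition argmin_set :: "('a \<Rightarrow> ereal) \<Rightarrow> 'a set" where
  "argmin_set f = {x. \<bar>f x\<bar> \<noteq> \<infinity> \<and> is_arg_min f (\<lambda>_. True) x}"

definition moreau_env :: "real \<Rightarrow> ('a::real_normed_vector \<Rightarrow> ereal) \<Rightarrow> 'a \<Rightarrow> ereal" where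
  "moreau_env \<mu> f x = (INF z. f z + ereal (1 / (2 * \<mu>) * (norm (z - x))\<^sup>2))"

text \<open>For proper, convex, lower semicontinuous \<open>f\<close> and \<open>\<mu> > 0\<close> the minimizer
  exists and is unique, so the choice made by \<^const>\<open>arg_min\<close> is immaterial.\<close>

definition prox :: "real \<Rightarrow> ('a::real_normed_vector \<Rightarrow> ereal) \<Rightarrow> 'a \<Rightarrow> 'a" where
  "prox \<mu> f x = arg_min (\<lambda>z. f z + ereal (1 / (2 * \<mu>) * (norm (z - x))\<^sup>2)) (\<lambda>_. True)"


section \<open>Expectations of random convex functions\<close>

text \<open>Expectation of an extended real random variable, as the difference of the integrals
  of its positive and negative parts (\<^const>\<open>e2ennreal\<close> maps negative numbers to \<open>0\<close>).
  On \<^typ>\<open>ereal\<close> we have \<open>\<infinity> - \<infinity> = \<infinity>\<close>, the usual convention in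
  stochastic programming.\<close>

definition ereal_expectation :: "'w measure \<Rightarrow> ('w \<Rightarrow> ereal) \<Rightarrow> ereal" where
  "ereal_expectation M X =
     enn2ereal (\<integral>\<^sup>+ w. e2ennreal (X w) \<partial>M) - enn2ereal (\<integral>\<^sup>+ w. e2ennreal (- X w) \<partial>M)"

text \<open>The last condition is the standard measurability requirement for random lower
  semicontinuous functions (normal integrands): the epigraph is a measurable set-valued
  map. It makes \<open>F x\<close>, the Moreau envelopes and the proximal points measurable in
  the random argument, so that the expectations and the algorithm below make sense.\<close>

definition random_convex_fun ::
  "'w measure \<Rightarrow> ('a::euclidean_space \<Rightarrow> 'w \<Rightarrow> ereal) \<Rightarrow> bool" where
  "random_convex_fun M F \<longleftrightarrow>
     (\<forall>w\<in>space M. proper_fun (\<lambda>x. F x w) \<and> convex_fun (\<lambda>x. F x w) \<and>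
                   lower_semicontinuous (\<lambda>x. F x w)) \<and>
     (\<forall>U. open U \<longrightarrow> {w \<in> space M. epi (\<lambda>x. F x w) \<inter> U \<noteq> {}} \<in> sets M)"

definition expected_fun :: "'w measure \<Rightarrow> ('a \<Rightarrow> 'w \<Rightarrow> ereal) \<Rightarrow> 'a \<Rightarrow> ereal" where
  "expected_fun M F x = ereal_expectation M (F x)"

definition optimal_set :: "'w measure \<Rightarrow> ('a \<Rightarrow> 'w \<Rightarrow> ereal) \<Rightarrow> 'a set" where
  "optimal_set M F = argmin_set (expected_fun M F)"

definition expected_env ::
  "'w measure \<Rightarrow> ('a::euclidean_space \<Rightarrow> 'w \<Rightarrow> ereal) \<Rightarrow> real \<Rightarrow> 'a \<Rightarrow> ereal" where
  "expected_env M F \<mu> x = ereal_expectation M (\<lambda>w. moreau_env \<mu> (\<lambda>y. F y w) x)"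


section \<open>Assumptions on the problem\<close>

text \<open>In the second conjunct, the subgradient mapping \<open>g\<close> is constrained only at
  points where the expected function is subdifferentiable. Elsewhere no selection with
  \<open>E[g x] \<in> \<partial>F(x)\<close> can exist, and imposing the condition at all points
  would force all functions to be finite everywhere.\<close>

definition basic_assumptions ::
  "'w measure \<Rightarrow> ('a::euclidean_space \<Rightarrow> 'w \<Rightarrow> ereal) \<Rightarrow> ('a \<Rightarrow> 'w \<Rightarrow> 'a) \<Rightarrow> real \<Rightarrow> bool" where
  "basic_assumptions M F g S \<longleftrightarrow>
     optimal_set M F \<noteq> {} \<and>
     (\<forall>x. subdifferential (expected_fun M F) x \<noteq> {} \<longrightarrow>
        (\<forall>w\<in>space M. g x w \<in> subdifferential (\<lambda>y. F y w) x) \<and>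
        integrable M (g x) \<and>
        (\<integral>w. g x w \<partial>M) \<in> subdifferential (expected_fun M F) x) \<and>
     0 \<le> S \<and>
     (\<forall>x\<in>optimal_set M F.
        integrable M (\<lambda>w. (norm (g x w))\<^sup>2) \<and> (\<integral>w. (norm (g x w))\<^sup>2 \<partial>M) \<le> S) \<and>
     (\<forall>x\<in>optimal_set M F. \<forall>v\<in>subdifferential (expected_fun M F) x.
        \<exists>h. (\<forall>w\<in>space M. h w \<in> subdifferential (\<lambda>y. F y w) x) \<and>
            bounded (h ` space M) \<and> integrable M h \<and>
            (\<integral>w. h w \<partial>M) = v \<and> (\<integral>w. (norm (h w))\<^sup>2 \<partial>M) < S) \<and>
     (\<forall>x\<in>optimal_set M F. (\<integral>w. g x w \<partial>M) = 0)"

text \<open>If \<open>optimal_set M F \<noteq> UNIV\<close>, letting \<open>x\<close> move away from the optimal set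
  shows that the inequality forces \<open>\<mu> * \<sigma> \<mu> \<le> 1\<close>. If \<open>optimal_set M F = UNIV\<close>,
  its left-hand side vanishes and \<open>\<sigma>\<close> is not bounded at all.\<close>

definition weak_linear_regularity ::
  "'w measure \<Rightarrow> ('a::euclidean_space \<Rightarrow> 'w \<Rightarrow> ereal) \<Rightarrow> (real \<Rightarrow> real) \<Rightarrow> real \<Rightarrow> bool" where
  "weak_linear_regularity M F \<sigma> \<beta> \<longleftrightarrow>
     0 \<le> \<beta> \<and>
     (\<forall>\<mu>>0. 0 < \<sigma> \<mu> \<and>
        (\<forall>x. ereal (\<sigma> \<mu> / 2 * (infdist x (optimal_set M F))\<^sup>2)
              \<le> expected_env M F \<mu> x - (INF y. expected_env M F \<mu> y) + ereal (\<mu> * \<beta>))) \<and>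
     antimono_on {0<..} \<sigma>"


section \<open>The stochastic proximal point algorithm\<close>

text \<open>The samples are independent random variables on a probability space \<open>N\<close>, all
  with distribution \<open>M\<close>.\<close>

definition iid_samples :: "'w measure \<Rightarrow> 's measure \<Rightarrow> (nat \<Rightarrow> 's \<Rightarrow> 'w) \<Rightarrow> bool" where
  "iid_samples M N \<xi> \<longleftrightarrow>
     prob_space.indep_vars N (\<lambda>_. M) \<xi> UNIV \<and> (\<forall>k. distr N M (\<xi> k) = M)"

primrec spp ::
  "('a::euclidean_space \<Rightarrow> 'w \<Rightarrow> ereal) \<Rightarrow> (nat \<Rightarrow> real) \<Rightarrow> (nat \<Rightarrow> 's \<Rightarrow> 'w) \<Rightarrow> 'a
    \<Rightarrow> nat \<Rightarrow> 's \<Rightarrow> 'a" where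
  "spp F \<mu> \<xi> x0 0 s = x0"
| "spp F \<mu> \<xi> x0 (Suc k) s = prox (\<mu> k) (\<lambda>y. F y (\<xi> k s)) (spp F \<mu> \<xi> x0 k s)"

end

theory Submission
  imports Defs
begin

text \<open>
  Fix an optimal point \<open>z\<close>. The objective defining the proximal point \<open>p\<close> of \<open>x\<close> for the sample
  \<open>w\<close> is strongly convex with modulus \<open>1/\<mu>\<close>, so comparing its values at \<open>p\<close> and \<open>z\<close> gives
  \<open>\<parallel>p - z\<parallel>\<^sup>2 \<le> \<parallel>x - z\<parallel>\<^sup>2 - 2\<mu> (F\<^sub>\<mu>(x; w) - F(z; w))\<close> (\<open>dist_prox_anchor\<close>). In expectation over \<open>w\<close>,
  the last bracket becomes \<open>F\<^sub>\<mu>(x) - F\<^sup>*\<close>. The subgradients \<open>g z w\<close> have mean zero and second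
  moment at most \<open>S\<close>, hence \<open>F\<^sub>\<mu>\<close> is nowhere below \<open>F\<^sup>* - \<mu> S / 2\<close>, and weak linear regularity
  yields \<open>F\<^sub>\<mu>(x) - F\<^sup>* \<ge> \<sigma>(\<mu>)/2 dist\<^sup>2(x) - \<mu> \<beta> - \<mu> S / 2\<close> (\<open>regularity_gap\<close>). Together, one step
  contracts the expected squared distance by the factor \<open>1 - \<mu> \<sigma>(\<mu>)\<close> up to the error
  \<open>\<mu>\<^sup>2 (S + 2\<beta>)\<close> (\<open>expected_prox_step\<close>).

  The current sample is independent of the current iterate, so the one-step estimate can be
  applied conditionally on the past (\<open>nn_integral_fresh_sample\<close>), and the claim follows by
  unrolling the recursion (\<open>expected_spp_bound\<close>).

  Unrolling needs nonnegative factors \<open>1 - \<mu> \<sigma>(\<mu>)\<close>. If the optimal set is not the whole space,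
  this is a consequence of regularity, because the distance to a convex set other than the whole
  space is unbounded (\<open>step_times_modulus_le_1\<close>); otherwise it is part of the hypotheses. Applying Fubini's theorem needs joint measurability of the proximal
  map in the point and the sample. It is continuous in the point and measurable in the sample
  (\<open>borel_measurable_prox_pair\<close>); the latter is derived from the measurability of the
  epigraph, by testing infima over open sets.
\<close>

section \<open>Proximal points of a convex function\<close>

definition prox_obj :: "real \<Rightarrow> ('a::real_normed_vector \<Rightarrow> ereal) \<Rightarrow> 'a \<Rightarrow> 'a \<Rightarrow> ereal" where
  "prox_obj \<mu> f x z = f z + ereal (1 / (2 * \<mu>) * (norm (z - x))\<^sup>2)"

lemma norm_convex_combination_sq:
  fixes a b x :: "'a::real_inner"
  shows "(norm (u *\<^sub>R a + (1 - u) *\<^sub>R b - x))\<^sup>2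
    = u * (norm (a - x))\<^sup>2 + (1 - u) * (norm (b - x))\<^sup>2 - u * (1 - u) * (norm (a - b))\<^sup>2"
  unfolding power2_norm_eq_inner
  by (simp add: inner_simps inner_commute algebra_simps power2_eq_square)

text \<open>Completing the square: the difference of the two sides is
  \<open>\<parallel>\<mu> v + (z - x)\<parallel>\<^sup>2 / (2\<mu>)\<close>. The Moreau envelope of an affine function with slope \<open>v\<close> is
  thus below the function by at most \<open>\<mu>/2 \<parallel>v\<parallel>\<^sup>2\<close>, which is where the second moment bound
  \<open>S\<close> in the final estimate comes from.\<close>

lemma linear_plus_quadratic_ge:
  fixes v x y z :: "'a::real_inner"
  assumes "0 < \<mu>"
  shows "v \<bullet> (x - y) - \<mu> / 2 * (norm v)\<^sup>2 \<le> v \<bullet> (z - y) + 1 / (2 * \<mu>) * (norm (z - x))\<^sup>2"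
proof -
  have square: "(norm (\<mu> *\<^sub>R v + (z - x)))\<^sup>2 = \<mu>\<^sup>2 * (norm v)\<^sup>2 + 2 * \<mu> * (v \<bullet> (z - x)) + (norm (z - x))\<^sup>2"
    using dot_norm[of "\<mu> *\<^sub>R v" "z - x"] by (simp add: power_mult_distrib)
  have "0 \<le> (norm (\<mu> *\<^sub>R v + (z - x)))\<^sup>2 / (2 * \<mu>)"
    using assms by simp
  also have "\<dots> = \<mu> / 2 * (norm v)\<^sup>2 + v \<bullet> (z - x) + 1 / (2 * \<mu>) * (norm (z - x))\<^sup>2"
    unfolding square using assms by (simp add: field_simps power2_eq_square)
  finally show ?thesis
    by (simp add: inner_diff_right)
qed

lemma prox_obj_strongly_convex:
  fixes f :: "'a::real_inner \<Rightarrow> ereal"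
  assumes "convex_fun f" "u \<in> {0<..<1}"
    and a: "prox_obj \<mu> f x a = ereal A" and b: "prox_obj \<mu> f x b = ereal B"
  shows "prox_obj \<mu> f x (u *\<^sub>R a + (1 - u) *\<^sub>R b)
    \<le> ereal (u * A + (1 - u) * B - u * (1 - u) / (2 * \<mu>) * (norm (a - b))\<^sup>2)"
proof -
  obtain \<alpha> where \<alpha>: "f a = ereal \<alpha>" "A = \<alpha> + 1 / (2 * \<mu>) * (norm (a - x))\<^sup>2"
    using a unfolding prox_obj_def by (cases "f a") auto
  obtain \<gamma> where \<gamma>: "f b = ereal \<gamma>" "B = \<gamma> + 1 / (2 * \<mu>) * (norm (b - x))\<^sup>2"
    using b unfolding prox_obj_def by (cases "f b") auto
  have "f (u *\<^sub>R a + (1 - u) *\<^sub>R b) \<le> ereal u * f a + ereal (1 - u) * f b"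
    using assms unfolding convex_fun_def by blast
  also have "\<dots> = ereal (u * \<alpha> + (1 - u) * \<gamma>)"
    by (simp add: \<alpha> \<gamma>)
  finally have "prox_obj \<mu> f x (u *\<^sub>R a + (1 - u) *\<^sub>R b) \<le> ereal (u * \<alpha> + (1 - u) * \<gamma>)
      + ereal (1 / (2 * \<mu>) * (norm (u *\<^sub>R a + (1 - u) *\<^sub>R b - x))\<^sup>2)"
    unfolding prox_obj_def by (rule add_right_mono)
  also have "\<dots> = ereal (u * A + (1 - u) * B - u * (1 - u) / (2 * \<mu>) * (norm (a - b))\<^sup>2)"
    unfolding norm_convex_combination_sq \<alpha> \<gamma> by (simp add: algebra_simps add_divide_distrib diff_divide_distrib)
  finally show ?thesis .
qed

lemma lower_semicontinuous_eventually_less: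
  fixes f :: "'a::t1_space \<Rightarrow> ereal"
  assumes "lower_semicontinuous f" "r < f x"
  shows "eventually (\<lambda>z. r < f z) (nhds x)"
proof -
  have "eventually (\<lambda>z. r < f z) (at x)"
    using assms unfolding lower_semicontinuous_def le_Liminf_iff by blast
  then show ?thesis
    using assms(2) unfolding eventually_at_filter by (auto elim!: eventually_mono)
qed

text \<open>This is how lower semicontinuity enters: limits of near-minimizers remain in the epigraph,
  and membership in the epigraph can be tested with countably many open balls.\<close>

lemma closed_epi:
  fixes f :: "'a::t1_space \<Rightarrow> ereal"
  assumes "lower_semicontinuous f"
  shows "closed (epi f)"
proof -
  have "open (- epi f)"
  proof (rule Topological_Spaces.openI)
    fix p assume p: "p \<in> - epi f"
    obtain x t where xt: "p = (x, t)" by (cases p)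
    have "ereal t < f x" using p xt by (auto simp: epi_def)
    then obtain r where r: "ereal t < r" "r < f x" using dense by blast
    obtain U where U: "open U" "x \<in> U" "\<And>z. z \<in> U \<Longrightarrow> r < f z"
      using lower_semicontinuous_eventually_less[OF assms r(2)] unfolding eventually_nhds by blast
    have V: "open {s. ereal s < r}"
      by (intro open_Collect_less continuous_intros)
    have "U \<times> {s. ereal s < r} \<subseteq> - epi f"
    proof safe
      fix z s assume "z \<in> U" "ereal s < r" "(z, s) \<in> epi f"
      then have "r < f z" "f z \<le> ereal s" using U(3) by (auto simp: epi_def)
      with \<open>ereal s < r\<close> show False by simp
    qed
    then show "\<exists>T. open T \<and> p \<in> T \<and> T \<subseteq> - epi f"
      using U V r xt by (intro exI[of _ "U \<times> {s. ereal s < r}"]) (auto intro: open_Times)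
  qed
  then show ?thesis by (simp add: closed_def)
qed

text \<open>The subgradient \<open>v\<close> at \<open>c\<close> provides an affine minorant of \<open>f\<close> and thereby bounds the proximal
  objective from below. In the application \<open>c\<close> is an optimal solution, where the basic assumptions
  supply a subgradient for every sample.\<close>

locale prox_function =
  fixes f :: "'a::euclidean_space \<Rightarrow> ereal" and c v :: 'a and \<mu> :: real
  assumes convex: "convex_fun f" and lsc: "lower_semicontinuous f"
    and subgradient: "v \<in> subdifferential f c"
    and pos: "0 < \<mu>"
begin

lemma f_anchor: "f c = ereal (real_of_ereal (f c))"
  using subgradient by (auto simp: subdifferential_def ereal_real)

lemma prox_obj_ge:
  "ereal (real_of_ereal (f c) + v \<bullet> (x - c) - \<mu> / 2 * (norm v)\<^sup>2) \<le> prox_obj \<mu> f x z"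
proof -
  have "ereal (real_of_ereal (f c) + v \<bullet> (x - c) - \<mu> / 2 * (norm v)\<^sup>2)
      \<le> ereal (real_of_ereal (f c) + v \<bullet> (z - c)) + ereal (1 / (2 * \<mu>) * (norm (z - x))\<^sup>2)"
    using linear_plus_quadratic_ge[OF pos, of v x c z] by simp
  also have "ereal (real_of_ereal (f c) + v \<bullet> (z - c)) \<le> f z"
    using subgradient f_anchor by (auto simp: subdifferential_def)
  finally show ?thesis unfolding prox_obj_def by (simp add: add_right_mono)
qed

lemma moreau_env_eq_INF: "moreau_env \<mu> f x = (INF z. prox_obj \<mu> f x z)"
  unfolding moreau_env_def prox_obj_def ..

lemma moreau_env_ge:
  "ereal (real_of_ereal (f c) + v \<bullet> (x - c) - \<mu> / 2 * (norm v)\<^sup>2) \<le> moreau_env \<mu> f x"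
  unfolding moreau_env_eq_INF by (rule INF_greatest) (rule prox_obj_ge)

lemma moreau_env_le: "moreau_env \<mu> f x \<le> prox_obj \<mu> f x z"
  unfolding moreau_env_eq_INF by (rule INF_lower) simp

lemma moreau_env_le_anchor:
  "moreau_env \<mu> f x \<le> ereal (real_of_ereal (f c) + 1 / (2 * \<mu>) * (norm (c - x))\<^sup>2)"
  using moreau_env_le[of x c] f_anchor unfolding prox_obj_def by (metis plus_ereal.simps(1))

lemma moreau_env_finite: "moreau_env \<mu> f x = ereal (real_of_ereal (moreau_env \<mu> f x))"
  using moreau_env_ge[of x] moreau_env_le_anchor[of x]
  by (cases "moreau_env \<mu> f x") auto

text \<open>Strong convexity at the midpoint makes every minimizing sequence Cauchy; the closed epigraph
  then contains its limit.\<close>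

lemma prox_minimizer_exists: "\<exists>p. prox_obj \<mu> f x p = moreau_env \<mu> f x"
proof -
  define m where "m = real_of_ereal (moreau_env \<mu> f x)"
  have m: "moreau_env \<mu> f x = ereal m" using moreau_env_finite m_def by simp
  have "\<exists>z. prox_obj \<mu> f x z < ereal (m + 1 / Suc n)" for n
  proof -
    have "(INF z. prox_obj \<mu> f x z) < ereal (m + 1 / Suc n)"
      using m unfolding moreau_env_eq_INF by simp
    then show ?thesis unfolding INF_less_iff by blast
  qed
  then obtain z where z: "\<And>n. prox_obj \<mu> f x (z n) < ereal (m + 1 / Suc n)" by metis
  have dist_z: "(dist (z i) (z j))\<^sup>2 \<le> 8 * \<mu> / Suc n" if ij: "n \<le> i" "n \<le> j" for i j n
  proof -
    have fin: "\<exists>A. prox_obj \<mu> f x (z i) = ereal A \<and> A \<le> m + 1 / Suc n" if "n \<le> i" for i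
    proof -
      have "ereal m \<le> prox_obj \<mu> f x (z i)" using moreau_env_le m by metis
      moreover have "1 / Suc i \<le> 1 / Suc n" using that by (simp add: frac_le)
      ultimately show ?thesis using z[of i] by (cases "prox_obj \<mu> f x (z i)") auto
    qed
    obtain A where A: "prox_obj \<mu> f x (z i) = ereal A" "A \<le> m + 1 / Suc n" using fin[OF ij(1)] by blast
    obtain B where B: "prox_obj \<mu> f x (z j) = ereal B" "B \<le> m + 1 / Suc n" using fin[OF ij(2)] by blast
    have "ereal m \<le> prox_obj \<mu> f x ((1/2) *\<^sub>R z i + (1 - 1/2) *\<^sub>R z j)"
      using moreau_env_le[of x] m by metis
    also have "\<dots> \<le> ereal (1/2 * A + (1 - 1/2) * B - 1/2 * (1 - 1/2) / (2 * \<mu>) * (norm (z i - z j))\<^sup>2)"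
      by (rule prox_obj_strongly_convex[OF convex _ A(1) B(1)]) simp
    finally have "(norm (z i - z j))\<^sup>2 / (8 * \<mu>) \<le> 1 / Suc n"
      using A(2) B(2) by simp
    then show ?thesis using pos by (simp add: dist_norm field_simps)
  qed
  have "Cauchy z"
  proof (rule metric_CauchyI)
    fix e :: real assume e: "0 < e"
    have "(\<lambda>n. 8 * \<mu> * (1 / Suc n)) \<longlonglongrightarrow> 8 * \<mu> * 0"
      by (intro tendsto_intros LIMSEQ_Suc[OF lim_1_over_n])
    then have "eventually (\<lambda>n. 8 * \<mu> * (1 / Suc n) < e\<^sup>2) sequentially"
      using e by (intro order_tendstoD) auto
    then obtain n where n: "8 * \<mu> * (1 / Suc n) < e\<^sup>2"
      using eventually_sequentially by auto
    have "dist (z i) (z j) < e" if "n \<le> i" "n \<le> j" for i j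
      by (rule power2_less_imp_less) (use dist_z[OF that] n e in auto)
    then show "\<exists>N. \<forall>i\<ge>N. \<forall>j\<ge>N. dist (z i) (z j) < e" by blast
  qed
  then obtain p where p: "z \<longlonglongrightarrow> p" using Cauchy_convergent convergent_def by blast
  define q where "q n = 1 / (2 * \<mu>) * (norm (z n - x))\<^sup>2" for n
  have lim: "(\<lambda>n. (z n, m + 1 / Suc n - q n)) \<longlonglongrightarrow> (p, m + 0 - 1 / (2 * \<mu>) * (norm (p - x))\<^sup>2)"
    unfolding q_def by (intro tendsto_intros p LIMSEQ_Suc[OF lim_1_over_n])
  have mem: "(z n, m + 1 / Suc n - q n) \<in> epi f" for n
    using z[of n] unfolding prox_obj_def epi_def q_def by (cases "f (z n)") auto
  have "(p, m + 0 - 1 / (2 * \<mu>) * (norm (p - x))\<^sup>2) \<in> epi f"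
    by (rule closed_sequentially[OF closed_epi[OF lsc] mem lim])
  then have "prox_obj \<mu> f x p \<le> ereal m"
    unfolding prox_obj_def epi_def by (cases "f p") auto
  then show ?thesis using moreau_env_le[of x p] m by (intro exI[of _ p] order_antisym) auto
qed

lemma prox_obj_prox: "prox_obj \<mu> f x (prox \<mu> f x) = moreau_env \<mu> f x"
proof -
  obtain p where p: "prox_obj \<mu> f x p = moreau_env \<mu> f x"
    using prox_minimizer_exists by blast
  have "is_arg_min (prox_obj \<mu> f x) (\<lambda>_. True) p"
    using p moreau_env_le[of x] by (simp add: is_arg_min_linorder)
  then have "is_arg_min (prox_obj \<mu> f x) (\<lambda>_. True) (arg_min (prox_obj \<mu> f x) (\<lambda>_. True))"
    unfolding arg_min_def by (rule someI)
  moreover have "arg_min (prox_obj \<mu> f x) (\<lambda>_. True) = prox \<mu> f x"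
    unfolding prox_def prox_obj_def ..
  ultimately have "prox_obj \<mu> f x (prox \<mu> f x) \<le> prox_obj \<mu> f x p"
    by (simp add: is_arg_min_linorder)
  then show ?thesis unfolding p using moreau_env_le by (rule order_antisym)
qed

lemma f_prox_finite: "\<exists>r. f (prox \<mu> f x) = ereal r"
proof -
  define m where "m = real_of_ereal (moreau_env \<mu> f x)"
  have "moreau_env \<mu> f x = ereal m" unfolding m_def by (rule moreau_env_finite)
  then have "f (prox \<mu> f x) + ereal (1 / (2 * \<mu>) * (norm (prox \<mu> f x - x))\<^sup>2) = ereal m"
    using prox_obj_prox[of x] unfolding prox_obj_def by (rule trans[rotated])
  then show ?thesis by (cases "f (prox \<mu> f x)") auto
qed

text \<open>The proximal objective grows quadratically around its minimizer \<open>p\<close>: compare the value at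
  \<open>p\<close> with the value at \<open>u y + (1 - u) p\<close>, divide by \<open>u\<close> and let \<open>u\<close> tend to \<open>0\<close>. The
  distance estimate, the stability of near-minimizers and the nonexpansiveness of the proximal
  map are instances of this inequality.\<close>

lemma prox_inequality:
  "moreau_env \<mu> f x + ereal (1 / (2 * \<mu>) * (norm (y - prox \<mu> f x))\<^sup>2) \<le> prox_obj \<mu> f x y"
proof (cases "prox_obj \<mu> f x y")
  case (real B)
  define m where "m = real_of_ereal (moreau_env \<mu> f x)"
  define D where "D = 1 / (2 * \<mu>) * (norm (y - prox \<mu> f x))\<^sup>2"
  have m: "moreau_env \<mu> f x = ereal m" using moreau_env_finite m_def by simp
  have "m \<le> B - (1 - u) * D" if u: "u \<in> {0<..<1}" for u
  proof -
    have "ereal m \<le> ereal (u * B + (1 - u) * m - u * (1 - u) / (2 * \<mu>) * (norm (y - prox \<mu> f x))\<^sup>2)"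
      using moreau_env_le[of x] prox_obj_strongly_convex[OF convex u real prox_obj_prox[of x, unfolded m]] m
      by (metis order_trans)
    then have "u * m \<le> u * (B - (1 - u) * D)"
      by (simp add: D_def algebra_simps)
    then show ?thesis using u by simp
  qed
  then have ev: "eventually (\<lambda>u. m \<le> B - (1 - u) * D) (at_right 0)"
    unfolding eventually_at_right_field by (intro exI[of _ 1]) auto
  have "((\<lambda>u. B - (1 - u) * D) \<longlongrightarrow> B - (1 - 0) * D) (at_right 0)"
    by (intro tendsto_intros)
  then have "m \<le> B - (1 - 0) * D"
    using ev by (rule tendsto_lowerbound) simp
  then show ?thesis using m real by (simp add: D_def)
next
  case MInf
  then show ?thesis using prox_obj_ge[of x y] by simp
qed simp

lemma dist_prox_anchor:
  "(norm (prox \<mu> f x - c))\<^sup>2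
    \<le> (norm (x - c))\<^sup>2 - 2 * \<mu> * (real_of_ereal (moreau_env \<mu> f x) - real_of_ereal (f c))"
proof -
  define P where "P = (norm (prox \<mu> f x - c))\<^sup>2"
  define X where "X = (norm (x - c))\<^sup>2"
  define e where "e = real_of_ereal (moreau_env \<mu> f x)"
  define \<alpha> where "\<alpha> = real_of_ereal (f c)"
  have e: "moreau_env \<mu> f x = ereal e" and \<alpha>: "f c = ereal \<alpha>"
    unfolding e_def \<alpha>_def by (rule moreau_env_finite, rule f_anchor)
  have "e + 1 / (2 * \<mu>) * P \<le> \<alpha> + 1 / (2 * \<mu>) * X"
    using prox_inequality[of x c]
    unfolding prox_obj_def e \<alpha> P_def X_def by (simp add: norm_minus_commute)
  then have le: "2 * \<mu> * (e + 1 / (2 * \<mu>) * P) \<le> 2 * \<mu> * (\<alpha> + 1 / (2 * \<mu>) * X)"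
    using pos by (intro mult_left_mono) auto
  have scale: "2 * \<mu> * (r + 1 / (2 * \<mu>) * t) = 2 * \<mu> * r + t" for r t
    using pos by (simp add: field_simps)
  have "P \<le> X - 2 * \<mu> * (e - \<alpha>)"
    using le unfolding scale by (simp add: right_diff_distrib)
  then show ?thesis unfolding P_def X_def e_def \<alpha>_def .
qed

text \<open>This reduces the measurability of the proximal point to that of infima over open sets.\<close>

lemma dist_near_minimizer:
  assumes "prox_obj \<mu> f x z < moreau_env \<mu> f x + ereal e"
  shows "(dist z (prox \<mu> f x))\<^sup>2 < 2 * \<mu> * e"
proof -
  have "moreau_env \<mu> f x + ereal (1 / (2 * \<mu>) * (norm (z - prox \<mu> f x))\<^sup>2) < moreau_env \<mu> f x + ereal e"
    using prox_inequality assms by (rule order.strict_trans1)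
  then have "1 / (2 * \<mu>) * (norm (z - prox \<mu> f x))\<^sup>2 < e"
    by (metis add_less_cancel_left ereal_less(1) less_ereal.simps(1) moreau_env_finite plus_ereal.simps(1))
  then show ?thesis using pos by (simp add: dist_norm field_simps)
qed

text \<open>Add the two growth inequalities at \<open>x\<close> and \<open>y\<close>, each evaluated at the other proximal point:
  the values of \<open>f\<close> cancel and the Cauchy-Schwarz inequality remains.\<close>

lemma prox_nonexpansive: "norm (prox \<mu> f x - prox \<mu> f y) \<le> norm (x - y)"
proof -
  define p q where "p = prox \<mu> f x" and "q = prox \<mu> f y"
  define n where "n a = (norm a)\<^sup>2" for a :: 'a
  have pq: "prox_obj \<mu> f x p = moreau_env \<mu> f x" "prox_obj \<mu> f y q = moreau_env \<mu> f y"
    using prox_obj_prox by (simp_all add: p_def q_def)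
  obtain \<alpha> where \<alpha>: "f p = ereal \<alpha>"
    using f_prox_finite[of x] unfolding p_def by blast
  obtain \<gamma> where \<gamma>: "f q = ereal \<gamma>"
    using f_prox_finite[of y] unfolding q_def by blast
  have "\<alpha> + 1 / (2 * \<mu>) * n (p - x) + 1 / (2 * \<mu>) * n (q - p) \<le> \<gamma> + 1 / (2 * \<mu>) * n (q - x)"
    using prox_inequality[of x q] \<alpha> \<gamma> unfolding pq(1)[symmetric] p_def[symmetric] prox_obj_def n_def by simp
  moreover have "\<gamma> + 1 / (2 * \<mu>) * n (q - y) + 1 / (2 * \<mu>) * n (p - q) \<le> \<alpha> + 1 / (2 * \<mu>) * n (p - y)"
    using prox_inequality[of y p] \<alpha> \<gamma> unfolding pq(2)[symmetric] q_def[symmetric] prox_obj_def n_def by simp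
  ultimately have "1 / (2 * \<mu>) * (n (p - x) + n (q - p) + n (q - y) + n (p - q))
      \<le> 1 / (2 * \<mu>) * (n (q - x) + n (p - y))"
    by (simp only: distrib_left)
  then have "n (p - x) + n (q - p) + n (q - y) + n (p - q) \<le> n (q - x) + n (p - y)"
    using pos by (simp add: divide_le_cancel)
  then have "2 * n (p - q) \<le> 2 * ((p - q) \<bullet> (x - y))"
    unfolding n_def power2_norm_eq_inner by (simp add: inner_simps inner_commute)
  then have "norm (p - q) * norm (p - q) \<le> norm (p - q) * norm (x - y)"
    unfolding n_def using norm_cauchy_schwarz[of "p - q" "x - y"] by (simp add: power2_eq_square)
  then show ?thesis
    unfolding p_def[symmetric] q_def[symmetric]
    by (cases "norm (p - q) = 0") (auto simp: mult_le_cancel_left)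
qed

end


section \<open>Measurability\<close>

text \<open>Approximate the first argument by simple functions: for each of the countably many
  values only the measurability in the second argument is used, and continuity permits
  passing to the limit.\<close>

lemma borel_measurable_Caratheodory:
  fixes h :: "'a::{second_countable_topology, metric_space} \<Rightarrow> 'w \<Rightarrow> 'b::metric_space"
  assumes meas: "\<And>x. h x \<in> borel_measurable M"
    and cont: "\<And>w. w \<in> space M \<Longrightarrow> continuous_on UNIV (\<lambda>x. h x w)"
  shows "(\<lambda>p. h (fst p) (snd p)) \<in> borel_measurable (borel \<Otimes>\<^sub>M M)"
proof -
  obtain d :: "nat \<Rightarrow> 'a \<Rightarrow> 'a"
    where d: "\<And>i. simple_function borel (d i)" "\<And>x. (\<lambda>i. d i x) \<longlonglongrightarrow> x"
    using borel_measurable_implies_sequence_metric[of "\<lambda>x. x" borel undefined] by auto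
  have "(\<lambda>p. h (d i (fst p)) (snd p)) \<in> borel_measurable (borel \<Otimes>\<^sub>M M)" for i
  proof (rule measurable_compose_countable'[of "range (d i)"])
    fix y show "(\<lambda>p. h y (snd p)) \<in> borel_measurable (borel \<Otimes>\<^sub>M M)"
      using measurable_compose[OF measurable_snd meas] .
  next
    have fin: "finite (range (d i))" using d(1)[of i] by (simp add: simple_function_def)
    show "countable (range (d i))" using fin by (rule countable_finite)
    have "d i \<in> borel \<rightarrow>\<^sub>M count_space (range (d i))"
      using d(1)[of i] fin by (auto simp: simple_function_def measurable_count_space_eq2)
    then show "(\<lambda>p. d i (fst p)) \<in> (borel \<Otimes>\<^sub>M M) \<rightarrow>\<^sub>M count_space (range (d i))"
      by (rule measurable_compose[OF measurable_fst])
  qed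
  then show ?thesis
  proof (rule borel_measurable_LIMSEQ_metric)
    fix p :: "'a \<times> 'w" assume "p \<in> space (borel \<Otimes>\<^sub>M M)"
    then have "snd p \<in> space M" by (auto simp: space_pair_measure)
    then show "(\<lambda>i. h (d i (fst p)) (snd p)) \<longlonglongrightarrow> h (fst p) (snd p)"
      using continuous_on_tendsto_compose[OF cont d(2)] by simp
  qed
qed

lemma random_convex_funD:
  assumes "random_convex_fun M F" "w \<in> space M"
  shows "proper_fun (\<lambda>x. F x w)" "convex_fun (\<lambda>x. F x w)" "lower_semicontinuous (\<lambda>x. F x w)"
  using assms unfolding random_convex_fun_def by auto

lemma sets_epi_hits_open:
  assumes "random_convex_fun M F" "open U"
  shows "{w \<in> space M. epi (\<lambda>x. F x w) \<inter> U \<noteq> {}} \<in> sets M"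
  using assms unfolding random_convex_fun_def by auto

text \<open>Since epigraphs are closed, \<open>F x w \<le> t\<close> holds iff every ball around \<open>(x, t)\<close> hits the
  epigraph.\<close>

lemma borel_measurable_integrand:
  assumes F: "random_convex_fun M F"
  shows "F x \<in> borel_measurable M"
proof (rule borel_measurableI_le)
  fix y :: ereal
  show "{w \<in> space M. F x w \<le> y} \<in> sets M"
  proof (cases y)
    case (real t)
    have "F x w \<le> y \<longleftrightarrow> (\<forall>n. epi (\<lambda>x. F x w) \<inter> ball (x, t) (1 / Suc n) \<noteq> {})"
      if w: "w \<in> space M" for w
    proof
      assume "F x w \<le> y"
      then have "(x, t) \<in> epi (\<lambda>x. F x w)" by (simp add: epi_def real)
      then show "\<forall>n. epi (\<lambda>x. F x w) \<inter> ball (x, t) (1 / Suc n) \<noteq> {}"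
        by (metis IntI centre_in_ball emptyE of_nat_0_less_iff zero_less_Suc zero_less_divide_1_iff)
    next
      assume hits: "\<forall>n. epi (\<lambda>x. F x w) \<inter> ball (x, t) (1 / Suc n) \<noteq> {}"
      have "\<exists>p\<in>epi (\<lambda>x. F x w). dist p (x, t) < e" if e: "0 < e" for e
      proof -
        obtain n where "1 / Suc n < e" using nat_approx_posE[OF e] by auto
        moreover obtain p where "p \<in> epi (\<lambda>x. F x w)" "p \<in> ball (x, t) (1 / Suc n)"
          using hits by blast
        ultimately show ?thesis by (intro bexI[of _ p]) (auto simp: dist_commute)
      qed
      then have "(x, t) \<in> closure (epi (\<lambda>x. F x w))"
        by (simp add: closure_approachable)
      then have "(x, t) \<in> epi (\<lambda>x. F x w)"
        using closed_epi[OF random_convex_funD(3)[OF F w]] by simp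
      then show "F x w \<le> y" by (simp add: epi_def real)
    qed
    then have "{w \<in> space M. F x w \<le> y}
        = {w \<in> space M. \<forall>n. w \<in> {w \<in> space M. epi (\<lambda>x. F x w) \<inter> ball (x, t) (1 / Suc n) \<noteq> {}}}"
      by auto
    also have "\<dots> \<in> sets M"
      using sets_epi_hits_open[OF F open_ball] by (intro sets.sets_Collect_countable_All) auto
    finally show ?thesis .
  next
    case MInf
    have "{w \<in> space M. F x w \<le> y} = {}"
      using random_convex_funD(1)[OF F] by (auto simp: MInf proper_fun_def)
    then show ?thesis by (metis sets.empty_sets)
  qed auto
qed

text \<open>An infimum over an open set \<open>U\<close> lies below \<open>y\<close> iff the epigraph hits an open subset of
  \<open>U \<times> \<real>\<close>.\<close>

lemma borel_measurable_INF_prox_obj: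
  fixes F :: "'a::euclidean_space \<Rightarrow> 'w \<Rightarrow> ereal"
  assumes F: "random_convex_fun M F" and U: "open U"
  shows "(\<lambda>w. INF z\<in>U. prox_obj \<mu> (\<lambda>y. F y w) x z) \<in> borel_measurable M"
proof (rule borel_measurableI_less)
  fix y :: ereal
  define V where "V = {p. fst p \<in> U \<and> ereal (snd p + 1 / (2 * \<mu>) * (norm (fst p - x))\<^sup>2) < y}"
  have "open {p :: 'a \<times> real. ereal (snd p + 1 / (2 * \<mu>) * (norm (fst p - x))\<^sup>2) < y}"
    by (intro open_Collect_less continuous_intros)
  moreover have "open {p :: 'a \<times> real. fst p \<in> U}"
    using open_vimage_fst[OF U] by (simp add: vimage_def)
  ultimately have "open V"
    unfolding V_def by (rule open_Collect_conj[rotated])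
  have "(INF z\<in>U. prox_obj \<mu> (\<lambda>y. F y w) x z) < y \<longleftrightarrow> epi (\<lambda>x. F x w) \<inter> V \<noteq> {}"
    if w: "w \<in> space M" for w
  proof -
    have "prox_obj \<mu> (\<lambda>y. F y w) x z < y \<longleftrightarrow>
        (\<exists>s. F z w \<le> ereal s \<and> ereal (s + 1 / (2 * \<mu>) * (norm (z - x))\<^sup>2) < y)" for z
    proof
      assume "prox_obj \<mu> (\<lambda>y. F y w) x z < y"
      moreover have "F z w \<noteq> -\<infinity>"
        using random_convex_funD(1)[OF F w] by (simp add: proper_fun_def)
      ultimately show "\<exists>s. F z w \<le> ereal s \<and> ereal (s + 1 / (2 * \<mu>) * (norm (z - x))\<^sup>2) < y"
        unfolding prox_obj_def by (cases "F z w") auto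
    next
      assume "\<exists>s. F z w \<le> ereal s \<and> ereal (s + 1 / (2 * \<mu>) * (norm (z - x))\<^sup>2) < y"
      then obtain s where s: "F z w \<le> ereal s" "ereal (s + 1 / (2 * \<mu>) * (norm (z - x))\<^sup>2) < y"
        by blast
      have "prox_obj \<mu> (\<lambda>y. F y w) x z \<le> ereal s + ereal (1 / (2 * \<mu>) * (norm (z - x))\<^sup>2)"
        unfolding prox_obj_def using s(1) by (rule add_right_mono)
      also have "\<dots> < y" using s(2) by simp
      finally show "prox_obj \<mu> (\<lambda>y. F y w) x z < y" .
    qed
    then have "(INF z\<in>U. prox_obj \<mu> (\<lambda>y. F y w) x z) < y \<longleftrightarrow>
        (\<exists>z\<in>U. \<exists>s. F z w \<le> ereal s \<and> ereal (s + 1 / (2 * \<mu>) * (norm (z - x))\<^sup>2) < y)"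
      unfolding INF_less_iff by simp
    also have "\<dots> \<longleftrightarrow> (\<exists>p. p \<in> epi (\<lambda>x. F x w) \<and> p \<in> V)"
      unfolding V_def epi_def by auto
    finally show ?thesis by blast
  qed
  then have "{w \<in> space M. (INF z\<in>U. prox_obj \<mu> (\<lambda>y. F y w) x z) < y}
      = {w \<in> space M. epi (\<lambda>x. F x w) \<inter> V \<noteq> {}}"
    by auto
  then show "{w \<in> space M. (INF z\<in>U. prox_obj \<mu> (\<lambda>y. F y w) x z) < y} \<in> sets M"
    using sets_epi_hits_open[OF F \<open>open V\<close>] by simp
qed

lemma borel_measurable_moreau_env:
  assumes "random_convex_fun M F"
  shows "(\<lambda>w. moreau_env \<mu> (\<lambda>y. F y w) x) \<in> borel_measurable M"
  using borel_measurable_INF_prox_obj[OF assms open_UNIV] unfolding moreau_env_def prox_obj_def .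

text \<open>For a closed set \<open>C\<close>, the proximal point lies in \<open>C\<close> iff the infimum of the objective over
  every neighbourhood \<open>U n\<close> of \<open>C\<close> equals its global infimum, because near-minimizers are close to
  the proximal point.\<close>

lemma borel_measurable_prox:
  fixes F :: "'a::euclidean_space \<Rightarrow> 'w \<Rightarrow> ereal"
  assumes F: "random_convex_fun M F" and \<mu>: "0 < \<mu>"
    and v: "\<And>w. w \<in> space M \<Longrightarrow> v w \<in> subdifferential (\<lambda>y. F y w) c"
  shows "(\<lambda>w. prox \<mu> (\<lambda>y. F y w) x) \<in> borel_measurable M"
proof (rule borel_measurableI)
  fix A :: "'a set" assume "open A"
  define C where "C = - A"
  have C: "closed C" using \<open>open A\<close> by (simp add: C_def closed_def)
  define U where "U n = {z. \<exists>y\<in>C. dist z y < 1 / Suc n}" for n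
  have U: "open (U n)" for n
  proof -
    have "U n = (\<Union>y\<in>C. ball y (1 / Suc n))" by (auto simp: U_def dist_commute)
    then show ?thesis by auto
  qed
  have "prox \<mu> (\<lambda>y. F y w) x \<in> C \<longleftrightarrow>
      (\<forall>n. (INF z\<in>U n. prox_obj \<mu> (\<lambda>y. F y w) x z) \<le> moreau_env \<mu> (\<lambda>y. F y w) x)"
    if w: "w \<in> space M" for w
  proof -
    interpret prox_function "\<lambda>y. F y w" c "v w" \<mu>
      using random_convex_funD[OF F w] v[OF w] \<mu> by unfold_locales
    let ?p = "prox \<mu> (\<lambda>y. F y w) x"
    show ?thesis
    proof
      assume p: "?p \<in> C"
      show "\<forall>n. (INF z\<in>U n. prox_obj \<mu> (\<lambda>y. F y w) x z) \<le> moreau_env \<mu> (\<lambda>y. F y w) x"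
      proof
        fix n
        have "?p \<in> U n" using p unfolding U_def by force
        then show "(INF z\<in>U n. prox_obj \<mu> (\<lambda>y. F y w) x z) \<le> moreau_env \<mu> (\<lambda>y. F y w) x"
          unfolding prox_obj_prox[symmetric] by (rule INF_lower)
      qed
    next
      assume le: "\<forall>n. (INF z\<in>U n. prox_obj \<mu> (\<lambda>y. F y w) x z) \<le> moreau_env \<mu> (\<lambda>y. F y w) x"
      have "\<exists>y\<in>C. dist y ?p < e" if e: "0 < e" for e
      proof -
        obtain n where n: "1 / Suc n < e / 2" using nat_approx_posE[of "e / 2"] e by auto
        \<comment> \<open>By \<open>dist_near_minimizer\<close>, an objective gap of \<open>\<delta>\<close> forces a distance below \<open>e / 2\<close>.\<close>
        define \<delta> where "\<delta> = (e / 2)\<^sup>2 / (2 * \<mu>)"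
        have "0 < \<delta>" using e \<mu> by (simp add: \<delta>_def)
        then have "moreau_env \<mu> (\<lambda>y. F y w) x < moreau_env \<mu> (\<lambda>y. F y w) x + ereal \<delta>"
          by (metis add.right_neutral ereal_less(2) ereal_less_add moreau_env_finite PInfty_neq_ereal(1) MInfty_neq_ereal(1) abs_ereal.simps(1))
        with le have "(INF z\<in>U n. prox_obj \<mu> (\<lambda>y. F y w) x z) < moreau_env \<mu> (\<lambda>y. F y w) x + ereal \<delta>"
          by (meson order.strict_trans1)
        then obtain z where z: "z \<in> U n" "prox_obj \<mu> (\<lambda>y. F y w) x z < moreau_env \<mu> (\<lambda>y. F y w) x + ereal \<delta>"
          unfolding INF_less_iff by blast
        have "(dist z ?p)\<^sup>2 < (e / 2)\<^sup>2"
          using dist_near_minimizer[OF z(2)] \<mu> by (simp add: \<delta>_def)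
        then have "dist z ?p < e / 2" by (rule power2_less_imp_less) (use e in simp)
        moreover obtain y where "y \<in> C" "dist z y < e / 2"
          using z(1) n unfolding U_def by force
        moreover have "dist y ?p \<le> dist z y + dist z ?p" by (rule dist_triangle3)
        ultimately show ?thesis by (intro bexI[of _ y]) auto
      qed
      then show "?p \<in> C" using C by (metis closed_approachable)
    qed
  qed
  then have "{w \<in> space M. prox \<mu> (\<lambda>y. F y w) x \<in> C} = {w \<in> space M. \<forall>n.
      (INF z\<in>U n. prox_obj \<mu> (\<lambda>y. F y w) x z) \<le> moreau_env \<mu> (\<lambda>y. F y w) x}"
    by blast
  also have "\<dots> \<in> sets M"
    using borel_measurable_INF_prox_obj[OF F U] borel_measurable_moreau_env[OF F]
    by (intro sets.sets_Collect_countable_All) measurable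
  finally have "space M - {w \<in> space M. prox \<mu> (\<lambda>y. F y w) x \<in> C} \<in> sets M" by blast
  moreover have "space M - {w \<in> space M. prox \<mu> (\<lambda>y. F y w) x \<in> C}
      = (\<lambda>w. prox \<mu> (\<lambda>y. F y w) x) -` A \<inter> space M"
    by (auto simp: C_def)
  ultimately show "(\<lambda>w. prox \<mu> (\<lambda>y. F y w) x) -` A \<inter> space M \<in> sets M" by simp
qed

lemma borel_measurable_prox_pair:
  fixes F :: "'a::euclidean_space \<Rightarrow> 'w \<Rightarrow> ereal"
  assumes F: "random_convex_fun M F" and \<mu>: "0 < \<mu>"
    and v: "\<And>w. w \<in> space M \<Longrightarrow> v w \<in> subdifferential (\<lambda>y. F y w) c"
  shows "(\<lambda>p. prox \<mu> (\<lambda>y. F y (snd p)) (fst p)) \<in> borel_measurable (borel \<Otimes>\<^sub>M M)"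
proof (rule borel_measurable_Caratheodory[of "\<lambda>x w. prox \<mu> (\<lambda>y. F y w) x"])
  show "(\<lambda>w. prox \<mu> (\<lambda>y. F y w) x) \<in> borel_measurable M" for x
    by (rule borel_measurable_prox[OF F \<mu> v])
  fix w assume w: "w \<in> space M"
  interpret prox_function "\<lambda>y. F y w" c "v w" \<mu>
    using random_convex_funD[OF F w] v[OF w] \<mu> by unfold_locales
  have "1-lipschitz_on UNIV (prox \<mu> (\<lambda>y. F y w))"
    using prox_nonexpansive by (intro lipschitz_onI) (auto simp: dist_norm)
  then show "continuous_on UNIV (prox \<mu> (\<lambda>y. F y w))"
    by (rule lipschitz_on_continuous_on)
qed


section \<open>Extended real expectations\<close>

lemma ereal_expectation_eq_integral:
  assumes f: "integrable M f" and eq: "\<And>w. w \<in> space M \<Longrightarrow> X w = ereal (f w)"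
  shows "ereal_expectation M X = ereal (\<integral>w. f w \<partial>M)"
proof -
  have 1: "(\<integral>\<^sup>+ w. e2ennreal (X w) \<partial>M) = (\<integral>\<^sup>+ w. ennreal (f w) \<partial>M)"
    by (rule nn_integral_cong) (simp add: eq)
  have 2: "(\<integral>\<^sup>+ w. e2ennreal (- X w) \<partial>M) = (\<integral>\<^sup>+ w. ennreal (- f w) \<partial>M)"
    by (rule nn_integral_cong) (simp add: eq)
  from f obtain r s where rs: "0 \<le> r" "0 \<le> s" "(\<integral>\<^sup>+ w. ennreal (f w) \<partial>M) = ennreal r"
      "(\<integral>\<^sup>+ w. ennreal (- f w) \<partial>M) = ennreal s" "(\<integral>w. f w \<partial>M) = r - s"
    by (rule integrableE)
  show ?thesis unfolding ereal_expectation_def 1 2 rs using rs(1,2) by simp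
qed

lemma integrable_of_finite_expectation:
  assumes X: "X \<in> borel_measurable M" and fin: "\<And>w. w \<in> space M \<Longrightarrow> \<bar>X w\<bar> \<noteq> \<infinity>"
    and E: "\<bar>ereal_expectation M X\<bar> \<noteq> \<infinity>"
  shows "integrable M (\<lambda>w. real_of_ereal (X w))"
proof -
  have 1: "(\<integral>\<^sup>+ w. e2ennreal (X w) \<partial>M) = (\<integral>\<^sup>+ w. ennreal (real_of_ereal (X w)) \<partial>M)"
    by (rule nn_integral_cong) (metis fin ereal_real' e2ennreal_ereal)
  have 2: "(\<integral>\<^sup>+ w. e2ennreal (- X w) \<partial>M) = (\<integral>\<^sup>+ w. ennreal (- real_of_ereal (X w)) \<partial>M)"
    by (rule nn_integral_cong) (metis fin ereal_real' e2ennreal_ereal uminus_ereal.simps(1))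
  define a where "a = enn2ereal (\<integral>\<^sup>+ w. e2ennreal (X w) \<partial>M)"
  define b where "b = enn2ereal (\<integral>\<^sup>+ w. e2ennreal (- X w) \<partial>M)"
  have "\<bar>a - b\<bar> \<noteq> \<infinity>" using E by (simp add: ereal_expectation_def a_def b_def)
  moreover have "0 \<le> a" "0 \<le> b" by (simp_all add: a_def b_def)
  ultimately have "a \<noteq> \<infinity>" "b \<noteq> \<infinity>" by (cases a; cases b; auto)+
  then have "(\<integral>\<^sup>+ w. ennreal (real_of_ereal (X w)) \<partial>M) \<noteq> \<infinity>"
      "(\<integral>\<^sup>+ w. ennreal (- real_of_ereal (X w)) \<partial>M) \<noteq> \<infinity>"
    unfolding a_def b_def 1 2 by auto
  then show ?thesis using X unfolding real_integrable_def by auto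
qed


section \<open>Convex sets at bounded distance from every point\<close>

text \<open>The distance is an infimum that need not be attained, so estimates are proved for every point
  of \<open>A\<close> and passed to the distance by this lemma.\<close>

lemma sq_le_infdist_sq:
  assumes "A \<noteq> {}" and le: "\<And>a. a \<in> A \<Longrightarrow> t \<le> (dist x a)\<^sup>2"
  shows "t \<le> (infdist x A)\<^sup>2"
proof (cases "0 \<le> t")
  case True
  have "sqrt t \<le> infdist x A"
    unfolding infdist_notempty[OF assms(1)]
    using assms(1) by (rule cINF_greatest) (use le in \<open>auto intro: real_le_lsqrt\<close>)
  then have "(sqrt t)\<^sup>2 \<le> (infdist x A)\<^sup>2"
    using True by (intro power_mono) auto
  then show ?thesis using True by simp
next
  case False
  then show ?thesis using zero_le_power2[of "infdist x A"] by linarith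
qed

text \<open>A point outside \<open>A\<close> is separated from \<open>A\<close> by a hyperplane; move away from \<open>A\<close> along its
  normal.\<close>

lemma convex_infdist_unbounded:
  fixes A :: "'a::euclidean_space set"
  assumes "convex A" "A \<noteq> {}" "A \<noteq> UNIV"
  shows "\<exists>x. R \<le> infdist x A"
proof -
  obtain y where y: "y \<notin> A" using assms(3) by blast
  obtain a b where a: "a \<noteq> 0" "\<And>z. z \<in> A \<Longrightarrow> a \<bullet> z \<le> b" "b \<le> a \<bullet> y"
    using separating_hyperplane_sets[of A "{y}"] assms y by auto
  define x where "x = y + (R / norm a) *\<^sub>R a"
  have "R \<le> dist x z" if z: "z \<in> A" for z
  proof -
    have "R * norm a = a \<bullet> x - a \<bullet> y"
      using a(1) by (simp add: x_def inner_add_right flip: power2_norm_eq_inner) (simp add: power2_eq_square)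
    also have "\<dots> \<le> a \<bullet> (x - z)"
      using a(2)[OF z] a(3) by (simp add: inner_diff_right)
    also have "\<dots> \<le> dist x z * norm a"
      using norm_cauchy_schwarz[of a "x - z"] by (simp add: dist_norm mult.commute)
    finally show ?thesis using a(1) by simp
  qed
  then have "R \<le> infdist x A"
    unfolding infdist_notempty[OF assms(2)] using assms(2) by (intro cINF_greatest)
  then show ?thesis ..
qed


section \<open>The expected decrease of one proximal step\<close>

locale stochastic_problem = prob_space M
  for M :: "'w measure" +
  fixes F :: "'a::euclidean_space \<Rightarrow> 'w \<Rightarrow> ereal" and g :: "'a \<Rightarrow> 'w \<Rightarrow> 'a" and S :: real
  assumes random: "random_convex_fun M F" and basic: "basic_assumptions M F g S"
begin

abbreviation X :: "'a set" where "X \<equiv> optimal_set M F"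

text \<open>The integrands are finite at optimal points and their Moreau envelopes are finite everywhere;
  the real-valued versions \<open>fval\<close> and \<open>env\<close> make the Bochner integral applicable to them.\<close>

definition fval :: "'a \<Rightarrow> 'w \<Rightarrow> real" where
  "fval z w = real_of_ereal (F z w)"

definition env :: "real \<Rightarrow> 'a \<Rightarrow> 'w \<Rightarrow> real" where
  "env \<mu> x w = real_of_ereal (moreau_env \<mu> (\<lambda>y. F y w) x)"

lemma X_nonempty: "X \<noteq> {}"
  using basic by (simp add: basic_assumptions_def)

lemma S_nonneg: "0 \<le> S"
  using basic by (simp add: basic_assumptions_def)

lemma expected_fun_optimal:
  assumes "z \<in> X"
  shows "\<bar>expected_fun M F z\<bar> \<noteq> \<infinity>" "\<And>y. expected_fun M F z \<le> expected_fun M F y"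
  using assms unfolding optimal_set_def argmin_set_def is_arg_min_linorder by auto

text \<open>The zero vector is a subgradient at a minimizer, so the selection \<open>g\<close> is available at all
  optimal points.\<close>

lemma subdifferential_optimal: "z \<in> X \<Longrightarrow> subdifferential (expected_fun M F) z \<noteq> {}"
  using expected_fun_optimal[of z] unfolding subdifferential_def
  by (auto intro!: exI[of _ 0] simp flip: zero_ereal_def)

lemma g_subgradient: "z \<in> X \<Longrightarrow> w \<in> space M \<Longrightarrow> g z w \<in> subdifferential (\<lambda>y. F y w) z"
  using basic subdifferential_optimal unfolding basic_assumptions_def by blast

lemma
  assumes "z \<in> X"
  shows integrable_g: "integrable M (g z)" and integral_g: "(\<integral>w. g z w \<partial>M) = 0"
    and integrable_norm_g: "integrable M (\<lambda>w. (norm (g z w))\<^sup>2)"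
    and integral_norm_g: "(\<integral>w. (norm (g z w))\<^sup>2 \<partial>M) \<le> S"
  using assms basic subdifferential_optimal[OF assms] unfolding basic_assumptions_def by auto

lemma prox_function_realization:
  assumes "z \<in> X" "w \<in> space M" "0 < \<mu>"
  shows "prox_function (\<lambda>y. F y w) z (g z w) \<mu>"
  using random_convex_funD[OF random assms(2)] g_subgradient[OF assms(1,2)] assms(3)
  by unfold_locales

lemma F_optimal_finite: "z \<in> X \<Longrightarrow> w \<in> space M \<Longrightarrow> F z w = ereal (fval z w)"
  unfolding fval_def using prox_function.f_anchor[OF prox_function_realization[where \<mu>=1]] by simp

lemma integrable_fval:
  assumes z: "z \<in> X"
  shows "integrable M (fval z)"
  unfolding fval_def
proof (rule integrable_of_finite_expectation)
  show "\<bar>ereal_expectation M (F z)\<bar> \<noteq> \<infinity>"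
    using expected_fun_optimal(1)[OF z] by (simp add: expected_fun_def)
qed (auto simp: borel_measurable_integrand[OF random] F_optimal_finite[OF z])

lemma expected_fun_eq: "z \<in> X \<Longrightarrow> expected_fun M F z = ereal (\<integral>w. fval z w \<partial>M)"
  unfolding expected_fun_def by (intro ereal_expectation_eq_integral integrable_fval F_optimal_finite)

text \<open>Let \<open>z\<close> be on the segment between optimal points \<open>x\<close> and \<open>y\<close>. Convexity bounds
  \<open>F z\<close> from above and the subgradient at \<open>x\<close> bounds it from below, both by integrable
  functions. So the expectation of \<open>F z\<close> is a true integral, and integrating the upper bound
  gives the optimal value.\<close>

lemma convex_X: "convex X"
proof (rule convexI)
  fix x y and u v :: real
  assume x: "x \<in> X" and y: "y \<in> X" and uv: "0 \<le> u" "0 \<le> v" "u + v = 1"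
  define z where "z = u *\<^sub>R x + v *\<^sub>R y"
  show "z \<in> X"
  proof (cases "u \<in> {0<..<1}")
    case False
    then have "u = 0 \<and> v = 1 \<or> u = 1 \<and> v = 0" using uv by auto
    then have "z = x \<or> z = y" by (auto simp: z_def)
    then show ?thesis using x y by auto
  next
    case u: True
    have v: "v = 1 - u" using uv by simp
    have upper: "F z w \<le> ereal (u * fval x w + (1 - u) * fval y w)" if w: "w \<in> space M" for w
    proof -
      have "F z w \<le> ereal u * F x w + ereal (1 - u) * F y w"
        using random_convex_funD(2)[OF random w] u unfolding convex_fun_def z_def v by blast
      then show ?thesis by (simp add: F_optimal_finite[OF x w] F_optimal_finite[OF y w])
    qed
    have lower: "ereal (fval x w + g x w \<bullet> (z - x)) \<le> F z w" if w: "w \<in> space M" for w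
      using g_subgradient[OF x w] F_optimal_finite[OF x w] unfolding subdifferential_def by auto
    have fin: "F z w = ereal (fval z w)" if w: "w \<in> space M" for w
      using upper[OF w] lower[OF w] unfolding fval_def by (cases "F z w") auto
    have meas: "fval z \<in> borel_measurable M"
      unfolding fval_def using borel_measurable_integrand[OF random] by measurable
    have int: "integrable M (fval z)"
    proof (rule Bochner_Integration.integrable_bound)
      show "integrable M (\<lambda>w. \<bar>fval x w + g x w \<bullet> (z - x)\<bar> + \<bar>u * fval x w + (1 - u) * fval y w\<bar>)"
        using integrable_fval[OF x] integrable_fval[OF y] integrable_g[OF x] by auto
      show "AE w in M. norm (fval z w)
          \<le> norm (\<bar>fval x w + g x w \<bullet> (z - x)\<bar> + \<bar>u * fval x w + (1 - u) * fval y w\<bar>)"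
        using upper lower fin by (intro AE_I2) (fastforce simp: abs_if)
    qed (rule meas)
    have opt: "expected_fun M F x = expected_fun M F y"
      using expected_fun_optimal(2)[OF x] expected_fun_optimal(2)[OF y] by (intro antisym)
    have "(\<integral>w. fval z w \<partial>M) \<le> (\<integral>w. u * fval x w + (1 - u) * fval y w \<partial>M)"
      using int integrable_fval[OF x] integrable_fval[OF y] upper fin
      by (intro integral_mono) auto
    also have "\<dots> = (\<integral>w. fval x w \<partial>M)"
      using integrable_fval[OF x] integrable_fval[OF y] opt expected_fun_eq[OF x] expected_fun_eq[OF y]
      by (simp add: algebra_simps)
    finally have le: "expected_fun M F z \<le> expected_fun M F x"
      unfolding expected_fun_eq[OF x]
      by (subst expected_fun_def) (simp add: ereal_expectation_eq_integral[OF int fin])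
    have "expected_fun M F z = ereal (\<integral>w. fval z w \<partial>M)"
      unfolding expected_fun_def by (rule ereal_expectation_eq_integral[OF int fin])
    then show ?thesis
      using le expected_fun_optimal(2)[OF x]
      unfolding optimal_set_def argmin_set_def is_arg_min_linorder by (auto intro: order_trans)
  qed
qed

lemma env_bounds:
  assumes "z \<in> X" "w \<in> space M" "0 < \<mu>"
  shows "fval z w + g z w \<bullet> (x - z) - \<mu> / 2 * (norm (g z w))\<^sup>2 \<le> env \<mu> x w"
    and "env \<mu> x w \<le> fval z w + 1 / (2 * \<mu>) * (dist x z)\<^sup>2"
    and "moreau_env \<mu> (\<lambda>y. F y w) x = ereal (env \<mu> x w)"
proof -
  interpret prox_function "\<lambda>y. F y w" z "g z w" \<mu>
    using assms by (rule prox_function_realization)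
  show fin: "moreau_env \<mu> (\<lambda>y. F y w) x = ereal (env \<mu> x w)"
    unfolding env_def by (rule moreau_env_finite)
  show "fval z w + g z w \<bullet> (x - z) - \<mu> / 2 * (norm (g z w))\<^sup>2 \<le> env \<mu> x w"
    using moreau_env_ge[of x] unfolding fin fval_def by simp
  show "env \<mu> x w \<le> fval z w + 1 / (2 * \<mu>) * (dist x z)\<^sup>2"
    using moreau_env_le_anchor[of x] unfolding fin fval_def by (simp add: dist_norm norm_minus_commute)
qed

lemma integrable_env:
  assumes \<mu>: "0 < \<mu>"
  shows "integrable M (env \<mu> x)"
proof -
  obtain z where z: "z \<in> X" using X_nonempty by blast
  let ?l = "\<lambda>w. fval z w + g z w \<bullet> (x - z) - \<mu> / 2 * (norm (g z w))\<^sup>2"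
  let ?u = "\<lambda>w. fval z w + 1 / (2 * \<mu>) * (dist x z)\<^sup>2"
  show ?thesis
  proof (rule Bochner_Integration.integrable_bound)
    show "integrable M (\<lambda>w. \<bar>?l w\<bar> + \<bar>?u w\<bar>)"
      using integrable_fval[OF z] integrable_g[OF z] integrable_norm_g[OF z] by auto
    show "AE w in M. norm (env \<mu> x w) \<le> norm (\<bar>?l w\<bar> + \<bar>?u w\<bar>)"
    proof (rule AE_I2)
      fix w assume "w \<in> space M"
      then show "norm (env \<mu> x w) \<le> norm (\<bar>?l w\<bar> + \<bar>?u w\<bar>)"
        using env_bounds(1,2)[OF z _ \<mu>, of w x] unfolding real_norm_def by linarith
    qed
    show "env \<mu> x \<in> borel_measurable M"
      unfolding env_def using borel_measurable_moreau_env[OF random] by measurable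
  qed
qed

lemma expected_env_eq: "0 < \<mu> \<Longrightarrow> expected_env M F \<mu> x = ereal (\<integral>w. env \<mu> x w \<partial>M)"
  unfolding expected_env_def
  using X_nonempty env_bounds(3) by (intro ereal_expectation_eq_integral integrable_env) auto

text \<open>Integrated form of the pointwise bounds. The linear term disappears because
  \<open>g z\<close> has mean \<open>0\<close>, and its second moment is at most \<open>S\<close>.\<close>

lemma integral_env_bounds:
  assumes z: "z \<in> X" and \<mu>: "0 < \<mu>"
  shows "(\<integral>w. fval z w \<partial>M) - \<mu> / 2 * S \<le> (\<integral>w. env \<mu> x w \<partial>M)"
    and "(\<integral>w. env \<mu> x w \<partial>M) \<le> (\<integral>w. fval z w \<partial>M) + 1 / (2 * \<mu>) * (dist x z)\<^sup>2"
proof -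
  note [simp] = integrable_fval[OF z] integrable_g[OF z] integrable_norm_g[OF z] integral_g[OF z]
  have "(\<integral>w. fval z w \<partial>M) - \<mu> / 2 * S \<le> (\<integral>w. fval z w \<partial>M) - \<mu> / 2 * (\<integral>w. (norm (g z w))\<^sup>2 \<partial>M)"
    using integral_norm_g[OF z] \<mu> by simp
  also have "\<dots> = (\<integral>w. fval z w + g z w \<bullet> (x - z) - \<mu> / 2 * (norm (g z w))\<^sup>2 \<partial>M)"
    by simp
  also have "\<dots> \<le> (\<integral>w. env \<mu> x w \<partial>M)"
    by (intro integral_mono integrable_env \<mu> env_bounds(1) z) auto
  finally show "(\<integral>w. fval z w \<partial>M) - \<mu> / 2 * S \<le> (\<integral>w. env \<mu> x w \<partial>M)" .
  have "(\<integral>w. env \<mu> x w \<partial>M) \<le> (\<integral>w. fval z w + 1 / (2 * \<mu>) * (dist x z)\<^sup>2 \<partial>M)"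
    by (intro integral_mono integrable_env \<mu> env_bounds(2) z) auto
  also have "\<dots> = (\<integral>w. fval z w \<partial>M) + 1 / (2 * \<mu>) * (dist x z)\<^sup>2"
    by (simp add: prob_space)
  finally show "(\<integral>w. env \<mu> x w \<partial>M) \<le> (\<integral>w. fval z w \<partial>M) + 1 / (2 * \<mu>) * (dist x z)\<^sup>2" .
qed

end

locale regular_stochastic_problem = stochastic_problem M F g S
  for M :: "'w measure" and F :: "'a::euclidean_space \<Rightarrow> 'w \<Rightarrow> ereal"
    and g :: "'a \<Rightarrow> 'w \<Rightarrow> 'a" and S :: real +
  fixes \<sigma> :: "real \<Rightarrow> real" and \<beta> :: real
  assumes regular: "weak_linear_regularity M F \<sigma> \<beta>"
begin

lemma \<beta>_nonneg: "0 \<le> \<beta>"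
  using regular by (simp add: weak_linear_regularity_def)

lemma \<sigma>_pos: "0 < \<mu> \<Longrightarrow> 0 < \<sigma> \<mu>"
  using regular by (simp add: weak_linear_regularity_def)

lemma \<sigma>_antimono: "0 < \<mu> \<Longrightarrow> \<mu> \<le> \<nu> \<Longrightarrow> \<sigma> \<nu> \<le> \<sigma> \<mu>"
  using regular unfolding weak_linear_regularity_def monotone_on_def by auto

text \<open>Weak linear regularity measures \<open>F\<^sub>\<mu>(x)\<close> against the infimum of \<open>F\<^sub>\<mu>\<close>, while a
  proximal step compares it with the minimum of \<open>F\<close>. The two values differ by at most
  \<open>\<mu> S / 2\<close>.\<close>

lemma regularity_gap:
  assumes z: "z \<in> X" and \<mu>: "0 < \<mu>"
  shows "\<sigma> \<mu> / 2 * (infdist x X)\<^sup>2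
    \<le> (\<integral>w. env \<mu> x w \<partial>M) - (\<integral>w. fval z w \<partial>M) + \<mu> / 2 * S + \<mu> * \<beta>"
proof -
  have "ereal ((\<integral>w. fval z w \<partial>M) - \<mu> / 2 * S) \<le> (INF y. expected_env M F \<mu> y)"
    unfolding expected_env_eq[OF \<mu>] by (rule INF_greatest) (use integral_env_bounds(1)[OF z \<mu>] in simp)
  then have "expected_env M F \<mu> x - (INF y. expected_env M F \<mu> y) + ereal (\<mu> * \<beta>)
      \<le> ereal (\<integral>w. env \<mu> x w \<partial>M) - ereal ((\<integral>w. fval z w \<partial>M) - \<mu> / 2 * S) + ereal (\<mu> * \<beta>)"
    unfolding expected_env_eq[OF \<mu>] by (intro add_right_mono ereal_minus_mono order_refl)
  moreover have "ereal (\<sigma> \<mu> / 2 * (infdist x X)\<^sup>2)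
      \<le> expected_env M F \<mu> x - (INF y. expected_env M F \<mu> y) + ereal (\<mu> * \<beta>)"
    using regular \<mu> unfolding weak_linear_regularity_def by blast
  ultimately have "ereal (\<sigma> \<mu> / 2 * (infdist x X)\<^sup>2)
      \<le> ereal (\<integral>w. env \<mu> x w \<partial>M) - ereal ((\<integral>w. fval z w \<partial>M) - \<mu> / 2 * S) + ereal (\<mu> * \<beta>)"
    by (rule order_trans[rotated])
  then show ?thesis by simp
qed

text \<open>Up to additive constants, the expected envelope is at most \<open>dist\<^sup>2 / (2\<mu>)\<close> and, by regularity,
  at least \<open>\<sigma>(\<mu>)/2 dist\<^sup>2\<close>. Since the distance to a convex set other than the whole space is unbounded,
  \<open>\<sigma>(\<mu>)\<close> cannot exceed \<open>1 / \<mu>\<close>. This makes the factors of the recursion nonnegative.\<close>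

lemma step_times_modulus_le_1:
  assumes "X \<noteq> UNIV" and \<mu>: "0 < \<mu>"
  shows "\<mu> * \<sigma> \<mu> \<le> 1"
proof (rule ccontr)
  assume "\<not> \<mu> * \<sigma> \<mu> \<le> 1"
  then have k: "0 < \<mu> * \<sigma> \<mu> - 1" by simp
  define K where "K = \<mu>\<^sup>2 * (S + 2 * \<beta>)"
  have "(\<mu> * \<sigma> \<mu> * (infdist x X)\<^sup>2 - K) \<le> (infdist x X)\<^sup>2" for x
  proof (rule sq_le_infdist_sq[OF X_nonempty])
    fix z assume z: "z \<in> X"
    have "\<sigma> \<mu> / 2 * (infdist x X)\<^sup>2 \<le> 1 / (2 * \<mu>) * (dist x z)\<^sup>2 + \<mu> / 2 * S + \<mu> * \<beta>"
      using regularity_gap[OF z \<mu>, of x] integral_env_bounds(2)[OF z \<mu>, of x] by linarith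
    then have "2 * \<mu> * (\<sigma> \<mu> / 2 * (infdist x X)\<^sup>2)
        \<le> 2 * \<mu> * (1 / (2 * \<mu>) * (dist x z)\<^sup>2 + \<mu> / 2 * S + \<mu> * \<beta>)"
      using \<mu> by (intro mult_left_mono) auto
    also have "\<dots> = (dist x z)\<^sup>2 + K"
      using \<mu> by (simp add: K_def field_simps power2_eq_square)
    finally show "\<mu> * \<sigma> \<mu> * (infdist x X)\<^sup>2 - K \<le> (dist x z)\<^sup>2" by simp
  qed
  then have bound: "(\<mu> * \<sigma> \<mu> - 1) * (infdist x X)\<^sup>2 \<le> K" for x
    by (simp add: left_diff_distrib diff_le_eq add.commute)
  have "0 \<le> K" using S_nonneg \<beta>_nonneg by (simp add: K_def)
  \<comment> \<open>The summand \<open>1\<close> gives \<open>R \<le> R\<^sup>2\<close> and makes the bound fail strictly.\<close>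
  define R where "R = K / (\<mu> * \<sigma> \<mu> - 1) + 1"
  have R: "1 \<le> R" using \<open>0 \<le> K\<close> k by (simp add: R_def)
  obtain x where x: "R \<le> infdist x X"
    using convex_infdist_unbounded[OF convex_X X_nonempty assms(1)] by blast
  have "R \<le> R\<^sup>2" using R by (simp add: power2_eq_square)
  also have "\<dots> \<le> (infdist x X)\<^sup>2" using x R by (intro power_mono) auto
  finally have "(\<mu> * \<sigma> \<mu> - 1) * R \<le> K" using bound[of x] k by (meson mult_left_mono less_imp_le order_trans)
  moreover have "(\<mu> * \<sigma> \<mu> - 1) * R = K + (\<mu> * \<sigma> \<mu> - 1)" using k by (simp add: R_def distrib_left)
  ultimately show False using k by simp
qed

text \<open>Integrate the pointwise estimate \<open>\<parallel>p - z\<parallel>\<^sup>2 \<le> \<parallel>x - z\<parallel>\<^sup>2 - 2\<mu> (F\<^sub>\<mu>(x; w) - F(z; w))\<close> for the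
  proximal point \<open>p\<close> of \<open>x\<close>, insert the regularity estimate, and only then take the infimum over the
  optimal points \<open>z\<close>.\<close>

lemma expected_prox_step:
  assumes \<mu>: "0 < \<mu>"
  shows "(\<integral>\<^sup>+ w. ennreal ((infdist (prox \<mu> (\<lambda>y. F y w) x) X)\<^sup>2) \<partial>M)
    \<le> ennreal ((1 - \<mu> * \<sigma> \<mu>) * (infdist x X)\<^sup>2 + \<mu>\<^sup>2 * (S + 2 * \<beta>))"
proof -
  let ?L = "\<integral>\<^sup>+ w. ennreal ((infdist (prox \<mu> (\<lambda>y. F y w) x) X)\<^sup>2) \<partial>M"
  define K where "K = \<mu>\<^sup>2 * (S + 2 * \<beta>) - \<mu> * \<sigma> \<mu> * (infdist x X)\<^sup>2"
  have step: "?L \<le> ennreal ((dist x z)\<^sup>2 + K) \<and> 0 \<le> (dist x z)\<^sup>2 + K" if z: "z \<in> X" for z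
  proof -
    let ?b = "\<lambda>w. (dist x z)\<^sup>2 - 2 * \<mu> * (env \<mu> x w - fval z w)"
    have prox_le: "(infdist (prox \<mu> (\<lambda>y. F y w) x) X)\<^sup>2 \<le> ?b w" if w: "w \<in> space M" for w
    proof -
      interpret prox_function "\<lambda>y. F y w" z "g z w" \<mu>
        using z w \<mu> by (rule prox_function_realization)
      have "(infdist (prox \<mu> (\<lambda>y. F y w) x) X)\<^sup>2 \<le> (dist (prox \<mu> (\<lambda>y. F y w) x) z)\<^sup>2"
        by (intro power_mono infdist_le z infdist_nonneg)
      also have "\<dots> \<le> ?b w"
        using dist_prox_anchor[of x] by (simp add: dist_norm env_def fval_def)
      finally show ?thesis .
    qed
    have b_nonneg: "0 \<le> ?b w" if "w \<in> space M" for w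
      using prox_le[OF that] zero_le_power2 order_trans by blast
    have int: "integrable M ?b"
      using integrable_env[OF \<mu>, of x] integrable_fval[OF z] by auto
    have "?L \<le> (\<integral>\<^sup>+ w. ennreal (?b w) \<partial>M)"
      using prox_le by (intro nn_integral_mono ennreal_leI)
    also have "\<dots> = ennreal (\<integral>w. ?b w \<partial>M)"
      using int b_nonneg by (intro nn_integral_eq_integral AE_I2)
    finally have L: "?L \<le> ennreal (\<integral>w. ?b w \<partial>M)" .
    have "(\<integral>w. ?b w \<partial>M) = (dist x z)\<^sup>2 - 2 * \<mu> * ((\<integral>w. env \<mu> x w \<partial>M) - (\<integral>w. fval z w \<partial>M))"
      using integrable_env[OF \<mu>, of x] integrable_fval[OF z] by (simp add: prob_space)
    also have "\<dots> \<le> (dist x z)\<^sup>2 - 2 * \<mu> * (\<sigma> \<mu> / 2 * (infdist x X)\<^sup>2 - \<mu> / 2 * S - \<mu> * \<beta>)"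
      using regularity_gap[OF z \<mu>, of x] \<mu> by (intro diff_left_mono mult_left_mono) auto
    also have "\<dots> = (dist x z)\<^sup>2 + K"
      by (simp add: K_def algebra_simps power2_eq_square)
    finally have le: "(\<integral>w. ?b w \<partial>M) \<le> (dist x z)\<^sup>2 + K" .
    moreover have "0 \<le> (\<integral>w. ?b w \<partial>M)"
      using b_nonneg by (intro integral_nonneg_AE AE_I2)
    ultimately show ?thesis
      using L ennreal_leI[OF le] by (meson order_trans)
  qed
  obtain z0 where z0: "z0 \<in> X" using X_nonempty by blast
  have "?L < top" using step[OF z0] by (auto intro: le_less_trans)
  then obtain l where l: "?L = ennreal l" "0 \<le> l" by (cases ?L) auto
  have "l - K \<le> (infdist x X)\<^sup>2"
  proof (rule sq_le_infdist_sq[OF X_nonempty])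
    fix z assume "z \<in> X"
    then show "l - K \<le> (dist x z)\<^sup>2" using step[of z] unfolding l by (auto simp: ennreal_le_iff)
  qed
  then have "l \<le> (1 - \<mu> * \<sigma> \<mu>) * (infdist x X)\<^sup>2 + \<mu>\<^sup>2 * (S + 2 * \<beta>)"
    by (simp add: K_def algebra_simps)
  then show ?thesis unfolding l by (rule ennreal_leI)
qed

end


section \<open>The iterates of the algorithm\<close>

context regular_stochastic_problem
begin

lemma prox_pair_measurable:
  assumes "0 < \<mu>"
  shows "(\<lambda>p. prox \<mu> (\<lambda>y. F y (snd p)) (fst p)) \<in> borel_measurable (borel \<Otimes>\<^sub>M M)"
proof -
  obtain z where "z \<in> X" using X_nonempty by blast
  then show ?thesis by (rule borel_measurable_prox_pair[OF random assms g_subgradient])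
qed

text \<open>Running the algorithm on the coordinate process exhibits the \<open>k\<close>-th iterate as a measurable
  function of the samples with index below \<open>k\<close>. The bound \<open>m\<close> keeps all iterates on one product
  space during the induction.\<close>

lemma spp_coordinates_measurable:
  assumes "\<And>i. 0 < \<mu> i" "k \<le> m"
  shows "spp F \<mu> (\<lambda>i \<omega>. \<omega> i) x0 k \<in> borel_measurable (PiM {..<m} (\<lambda>_. M))"
  using assms(2)
proof (induction k)
  case 0
  have "spp F \<mu> (\<lambda>i \<omega>. \<omega> i) x0 0 = (\<lambda>_. x0)" by auto
  then show ?case by simp
next
  case (Suc k)
  have "(\<lambda>\<omega>. (spp F \<mu> (\<lambda>i \<omega>. \<omega> i) x0 k \<omega>, \<omega> k)) \<in> PiM {..<m} (\<lambda>_. M) \<rightarrow>\<^sub>M borel \<Otimes>\<^sub>M M"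
    using Suc by (intro measurable_Pair measurable_component_singleton) auto
  from measurable_compose[OF this prox_pair_measurable[OF assms(1)[of k]]] show ?case by simp
qed

lemma spp_depends_on_past: "spp F \<mu> (\<lambda>i \<omega>. \<omega> i) x0 k (restrict (\<lambda>i. \<xi> i s) {..<m}) = spp F \<mu> \<xi> x0 k s"
  if "k \<le> m"
  using that by (induction k) auto

lemma iid_samples_measurable: "iid_samples M N \<xi> \<Longrightarrow> prob_space N \<Longrightarrow> \<xi> i \<in> N \<rightarrow>\<^sub>M M"
  unfolding iid_samples_def by (auto simp: prob_space.indep_vars_def)

lemma spp_measurable:
  assumes N: "prob_space N" and iid: "iid_samples M N \<xi>" and \<mu>: "\<And>i. 0 < \<mu> i"
  shows "spp F \<mu> \<xi> x0 k \<in> borel_measurable N"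
proof -
  have "(\<lambda>s. restrict (\<lambda>i. \<xi> i s) {..<k}) \<in> N \<rightarrow>\<^sub>M PiM {..<k} (\<lambda>_. M)"
    by (intro measurable_restrict iid_samples_measurable[OF iid N])
  from measurable_compose[OF this spp_coordinates_measurable[OF \<mu> order_refl]]
  show ?thesis by (simp add: spp_depends_on_past)
qed

text \<open>The past samples and the current one are independent, so their joint law is a product and
  Fubini's theorem applies. The current sample is kept as a family over the index set \<open>{k}\<close>
  because \<^const>\<open>prob_space.indep_var\<close> relates only random variables with values in one
  common type.\<close>

lemma nn_integral_fresh_sample:
  assumes N: "prob_space N" and iid: "iid_samples M N \<xi>" and \<mu>: "\<And>i. 0 < \<mu> i"
    and \<phi>: "\<phi> \<in> borel_measurable (borel \<Otimes>\<^sub>M M)"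
  shows "(\<integral>\<^sup>+ s. \<phi> (spp F \<mu> \<xi> x0 k s, \<xi> k s) \<partial>N) = (\<integral>\<^sup>+ s. \<integral>\<^sup>+ w. \<phi> (spp F \<mu> \<xi> x0 k s, w) \<partial>M \<partial>N)"
proof -
  interpret N: prob_space N by (rule N)
  let ?past = "\<lambda>s. restrict (\<lambda>i. \<xi> i s) {..<k}" and ?now = "\<lambda>s. restrict (\<lambda>i. \<xi> i s) {k}"
  let ?P = "PiM {..<k} (\<lambda>_. M)" and ?Q = "PiM {k} (\<lambda>_. M)"
  let ?H = "spp F \<mu> (\<lambda>i \<omega>. \<omega> i) x0 k"
  have "N.indep_var ?P ?past ?Q ?now"
    using iid unfolding iid_samples_def by (intro N.indep_var_restrict[of _ _ UNIV]) auto
  then have past: "?past \<in> N \<rightarrow>\<^sub>M ?P" and now: "?now \<in> N \<rightarrow>\<^sub>M ?Q"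
    and joint: "distr N ?P ?past \<Otimes>\<^sub>M distr N ?Q ?now = distr N (?P \<Otimes>\<^sub>M ?Q) (\<lambda>s. (?past s, ?now s))"
    unfolding N.indep_var_distribution_eq by blast+
  have H: "?H \<in> borel_measurable ?P" by (rule spp_coordinates_measurable[OF \<mu> order_refl])
  have H_past: "?H (?past s) = spp F \<mu> \<xi> x0 k s" for s by (simp add: spp_depends_on_past)
  have \<phi>': "(\<lambda>p. \<phi> (?H (fst p), snd p k)) \<in> borel_measurable (?P \<Otimes>\<^sub>M ?Q)"
    by (intro measurable_compose[OF _ \<phi>] measurable_Pair measurable_compose[OF measurable_fst H]
        measurable_compose[OF measurable_snd measurable_component_singleton]) simp
  interpret Q: prob_space "distr N ?Q ?now" using now by (rule N.prob_space_distr)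
  have sample: "(\<integral>\<^sup>+ b. \<phi> (y, b k) \<partial>distr N ?Q ?now) = (\<integral>\<^sup>+ w. \<phi> (y, w) \<partial>M)" for y
  proof -
    have \<phi>_y: "(\<lambda>w. \<phi> (y, w)) \<in> borel_measurable M"
      by (rule measurable_compose[OF measurable_Pair1' \<phi>]) simp
    have "(\<lambda>b. \<phi> (y, b k)) \<in> borel_measurable ?Q"
      by (rule measurable_compose[OF _ \<phi>_y]) (rule measurable_component_singleton, simp)
    then have "(\<integral>\<^sup>+ b. \<phi> (y, b k) \<partial>distr N ?Q ?now) = (\<integral>\<^sup>+ s. \<phi> (y, \<xi> k s) \<partial>N)"
      using now by (subst nn_integral_distr) auto
    also have "\<dots> = (\<integral>\<^sup>+ w. \<phi> (y, w) \<partial>distr N M (\<xi> k))"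
      using iid_samples_measurable[OF iid N] \<phi>_y by (subst nn_integral_distr) auto
    finally show ?thesis using iid by (simp add: iid_samples_def)
  qed
  have "(\<integral>\<^sup>+ s. \<phi> (spp F \<mu> \<xi> x0 k s, \<xi> k s) \<partial>N)
      = (\<integral>\<^sup>+ p. \<phi> (?H (fst p), snd p k) \<partial>(distr N ?P ?past \<Otimes>\<^sub>M distr N ?Q ?now))"
    unfolding joint using past now \<phi>' by (subst nn_integral_distr) (auto simp: H_past)
  also have "\<dots> = (\<integral>\<^sup>+ a. \<integral>\<^sup>+ b. \<phi> (?H a, b k) \<partial>distr N ?Q ?now \<partial>distr N ?P ?past)"
    using \<phi>' by (subst Q.nn_integral_fst[symmetric]) (auto cong: measurable_cong_sets)
  also have "\<dots> = (\<integral>\<^sup>+ a. \<integral>\<^sup>+ w. \<phi> (?H a, w) \<partial>M \<partial>distr N ?P ?past)"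
    by (simp only: sample)
  also have "\<dots> = (\<integral>\<^sup>+ s. \<integral>\<^sup>+ w. \<phi> (spp F \<mu> \<xi> x0 k s, w) \<partial>M \<partial>N)"
    using past measurable_compose[OF H borel_measurable_nn_integral_fst[OF \<phi>]]
    by (subst nn_integral_distr) (auto simp: H_past)
  finally show ?thesis .
qed

lemma borel_measurable_infdist_sq: "(\<lambda>x. ennreal ((infdist x A)\<^sup>2)) \<in> borel_measurable borel"
  by (intro measurable_compose[OF _ measurable_ennreal] borel_measurable_continuous_onI continuous_intros)

text \<open>The modulus \<open>\<sigma> (\<mu> k)\<close> is replaced by a smaller \<open>\<tau>\<close> that does not depend on \<open>k\<close>.
  Nonnegative integrals give the estimate a meaning before the integrability of the squared
  distances is established, which is a consequence of it.\<close>

lemma expected_spp_step: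
  assumes N: "prob_space N" and iid: "iid_samples M N \<xi>" and \<mu>: "\<And>i. 0 < \<mu> i"
    and \<tau>: "\<tau> \<le> \<sigma> (\<mu> k)" "\<mu> k * \<tau> \<le> 1"
  shows "(\<integral>\<^sup>+ s. ennreal ((infdist (spp F \<mu> \<xi> x0 (Suc k) s) X)\<^sup>2) \<partial>N)
    \<le> ennreal (1 - \<mu> k * \<tau>) * (\<integral>\<^sup>+ s. ennreal ((infdist (spp F \<mu> \<xi> x0 k s) X)\<^sup>2) \<partial>N)
      + ennreal ((\<mu> k)\<^sup>2 * (S + 2 * \<beta>))"
proof -
  interpret N: prob_space N by (rule N)
  let ?Y = "spp F \<mu> \<xi> x0 k"
  let ?\<phi> = "\<lambda>p. ennreal ((infdist (prox (\<mu> k) (\<lambda>y. F y (snd p)) (fst p)) X)\<^sup>2)"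
  have Y: "?Y \<in> borel_measurable N"
    by (rule spp_measurable[OF N iid \<mu>])
  have K: "0 \<le> (\<mu> k)\<^sup>2 * (S + 2 * \<beta>)" using S_nonneg \<beta>_nonneg by simp
  have "(\<integral>\<^sup>+ s. ennreal ((infdist (spp F \<mu> \<xi> x0 (Suc k) s) X)\<^sup>2) \<partial>N) = (\<integral>\<^sup>+ s. ?\<phi> (?Y s, \<xi> k s) \<partial>N)"
    by simp
  also have "\<dots> = (\<integral>\<^sup>+ s. \<integral>\<^sup>+ w. ?\<phi> (?Y s, w) \<partial>M \<partial>N)"
    using measurable_compose[OF prox_pair_measurable[OF \<mu>] borel_measurable_infdist_sq]
    by (rule nn_integral_fresh_sample[OF N iid \<mu>])
  also have "\<dots> \<le> (\<integral>\<^sup>+ s. ennreal (1 - \<mu> k * \<tau>) * ennreal ((infdist (?Y s) X)\<^sup>2)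
      + ennreal ((\<mu> k)\<^sup>2 * (S + 2 * \<beta>)) \<partial>N)"
  proof (rule nn_integral_mono)
    fix s
    have "\<mu> k * \<tau> * (infdist (?Y s) X)\<^sup>2 \<le> \<mu> k * \<sigma> (\<mu> k) * (infdist (?Y s) X)\<^sup>2"
      using \<tau>(1) \<mu>[of k] by (intro mult_right_mono mult_left_mono) auto
    then have "(1 - \<mu> k * \<sigma> (\<mu> k)) * (infdist (?Y s) X)\<^sup>2 + (\<mu> k)\<^sup>2 * (S + 2 * \<beta>)
        \<le> (1 - \<mu> k * \<tau>) * (infdist (?Y s) X)\<^sup>2 + (\<mu> k)\<^sup>2 * (S + 2 * \<beta>)"
      by (simp add: left_diff_distrib)
    from order_trans[OF expected_prox_step[OF \<mu>] ennreal_leI[OF this]]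
    show "(\<integral>\<^sup>+ w. ?\<phi> (?Y s, w) \<partial>M) \<le> ennreal (1 - \<mu> k * \<tau>) * ennreal ((infdist (?Y s) X)\<^sup>2)
        + ennreal ((\<mu> k)\<^sup>2 * (S + 2 * \<beta>))"
      using \<tau>(2) K by (simp add: ennreal_plus ennreal_mult)
  qed
  also have "\<dots> = ennreal (1 - \<mu> k * \<tau>) * (\<integral>\<^sup>+ s. ennreal ((infdist (?Y s) X)\<^sup>2) \<partial>N)
      + ennreal ((\<mu> k)\<^sup>2 * (S + 2 * \<beta>))"
    using measurable_compose[OF Y borel_measurable_infdist_sq]
    by (simp add: nn_integral_add nn_integral_cmult N.emeasure_space_1)
  finally show ?thesis .
qed

lemma expected_spp_bound:
  assumes N: "prob_space N" and iid: "iid_samples M N \<xi>" and \<mu>: "\<And>i. 0 < \<mu> i"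
    and \<tau>: "\<And>i. \<tau> \<le> \<sigma> (\<mu> i)" "\<And>i. \<mu> i * \<tau> \<le> 1"
  shows "(\<integral>\<^sup>+ s. ennreal ((infdist (spp F \<mu> \<xi> x k s) X)\<^sup>2) \<partial>N)
    \<le> ennreal ((\<Prod>i=0..<k. 1 - \<mu> i * \<tau>) * (infdist x X)\<^sup>2
        + (S + 2 * \<beta>) * (\<Sum>i=0..<k. (\<Prod>j=i+1..<k. 1 - \<mu> j * \<tau>) * (\<mu> i)\<^sup>2))"
proof (induction k)
  case 0
  interpret N: prob_space N by (rule N)
  show ?case by (simp add: N.emeasure_space_1)
next
  case (Suc k)
  let ?P = "\<lambda>i k. \<Prod>j=i..<k. 1 - \<mu> j * \<tau>"
  let ?A = "?P 0 k * (infdist x X)\<^sup>2 + (S + 2 * \<beta>) * (\<Sum>i=0..<k. ?P (i+1) k * (\<mu> i)\<^sup>2)"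
  have q: "0 \<le> 1 - \<mu> i * \<tau>" for i using \<tau>(2)[of i] by simp
  have P: "0 \<le> ?P i k" for i by (intro prod_nonneg) (use q in auto)
  have A: "0 \<le> ?A"
    using P S_nonneg \<beta>_nonneg by (intro add_nonneg_nonneg mult_nonneg_nonneg sum_nonneg) auto
  have "(\<Sum>i=0..<Suc k. ?P (i+1) (Suc k) * (\<mu> i)\<^sup>2)
      = (\<Sum>i=0..<k. (1 - \<mu> k * \<tau>) * (?P (i+1) k * (\<mu> i)\<^sup>2)) + (\<mu> k)\<^sup>2"
    by (simp add: prod.atLeastLessThan_Suc mult_ac cong: sum.cong_simp)
  also have "\<dots> = (1 - \<mu> k * \<tau>) * (\<Sum>i=0..<k. ?P (i+1) k * (\<mu> i)\<^sup>2) + (\<mu> k)\<^sup>2"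
    by (simp add: sum_distrib_left)
  finally have rec: "?P 0 (Suc k) * (infdist x X)\<^sup>2
      + (S + 2 * \<beta>) * (\<Sum>i=0..<Suc k. ?P (i+1) (Suc k) * (\<mu> i)\<^sup>2)
      = (1 - \<mu> k * \<tau>) * ?A + (\<mu> k)\<^sup>2 * (S + 2 * \<beta>)"
    by (simp only: prod.atLeastLessThan_Suc zero_le distrib_left mult_ac)
  have "(\<integral>\<^sup>+ s. ennreal ((infdist (spp F \<mu> \<xi> x (Suc k) s) X)\<^sup>2) \<partial>N)
      \<le> ennreal (1 - \<mu> k * \<tau>) * ennreal ?A + ennreal ((\<mu> k)\<^sup>2 * (S + 2 * \<beta>))"
    by (rule order_trans[OF expected_spp_step[OF N iid \<mu> \<tau>] add_right_mono[OF mult_left_mono[OF Suc.IH]]]) simp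
  also have "\<dots> = ennreal ((1 - \<mu> k * \<tau>) * ?A + (\<mu> k)\<^sup>2 * (S + 2 * \<beta>))"
    using q A S_nonneg \<beta>_nonneg by (simp add: ennreal_plus ennreal_mult)
  finally show ?case unfolding rec .
qed

end

text \<open>The modulus at the largest stepsize \<open>\<mu> 0\<close> serves as the uniform \<open>\<tau>\<close>: stepsizes decrease and \<open>\<sigma>\<close>
  is antitone.\<close>

theorem theorem4p2:
  fixes M :: "'w measure" and N :: "'s measure"
    and F :: "'a::euclidean_space \<Rightarrow> 'w \<Rightarrow> ereal"
    and g :: "'a \<Rightarrow> 'w \<Rightarrow> 'a"
    and S \<beta> :: real and \<sigma> :: "real \<Rightarrow> real"
    and \<mu> :: "nat \<Rightarrow> real" and \<xi> :: "nat \<Rightarrow> 's \<Rightarrow> 'w" and x0 :: 'a and k :: nat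
  assumes "prob_space M"
    and "random_convex_fun M F"
    and "basic_assumptions M F g S"
    and "weak_linear_regularity M F \<sigma> \<beta>"
    and "\<And>i. 0 < \<mu> i" and "decseq \<mu>"
    and "optimal_set M F = UNIV \<Longrightarrow> \<mu> 0 * \<sigma> (\<mu> 0) \<le> 1"
    and "prob_space N" and "iid_samples M N \<xi>"
  shows "integrable N (\<lambda>s. (infdist (spp F \<mu> \<xi> x0 (Suc k) s) (optimal_set M F))\<^sup>2) \<and>
    (\<integral>s. (infdist (spp F \<mu> \<xi> x0 (Suc k) s) (optimal_set M F))\<^sup>2 \<partial>N)
      \<le> (\<Prod>i=0..k. 1 - \<mu> i * \<sigma> (\<mu> 0)) * (infdist x0 (optimal_set M F))\<^sup>2
        + (S + 2 * \<beta>) * (\<Sum>i=0..k. (\<Prod>j=i+1..k. 1 - \<mu> j * \<sigma> (\<mu> 0)) * (\<mu> i)\<^sup>2)"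
proof -
  interpret stochastic_problem M F g S
    using assms(1-3) by (simp add: stochastic_problem_def stochastic_problem_axioms_def)
  interpret regular_stochastic_problem M F g S \<sigma> \<beta>
    using assms(4) by unfold_locales
  interpret N: prob_space N by (rule assms(8))
  let ?\<tau> = "\<sigma> (\<mu> 0)"
  have \<mu>_le: "\<mu> i \<le> \<mu> 0" for i using \<open>decseq \<mu>\<close> by (simp add: decseq_def)
  have \<tau>: "?\<tau> \<le> \<sigma> (\<mu> i)" for i by (rule \<sigma>_antimono[OF assms(5) \<mu>_le])
  have "\<mu> 0 * ?\<tau> \<le> 1"
    using assms(7) step_times_modulus_le_1[OF _ assms(5)] by blast
  then have \<mu>\<tau>: "\<mu> i * ?\<tau> \<le> 1" for i
    using mult_right_mono[OF \<mu>_le[of i], of ?\<tau>] \<sigma>_pos[OF assms(5), of 0] by linarith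
  define A where "A = (\<Prod>i=0..k. 1 - \<mu> i * ?\<tau>) * (infdist x0 X)\<^sup>2
        + (S + 2 * \<beta>) * (\<Sum>i=0..k. (\<Prod>j=i+1..k. 1 - \<mu> j * ?\<tau>) * (\<mu> i)\<^sup>2)"
  let ?D = "\<lambda>s. (infdist (spp F \<mu> \<xi> x0 (Suc k) s) X)\<^sup>2"
  have bound: "(\<integral>\<^sup>+ s. ennreal (?D s) \<partial>N) \<le> ennreal A"
    using expected_spp_bound[where \<mu> = \<mu> and x = x0 and k = "Suc k", OF assms(8,9,5) \<tau> \<mu>\<tau>]
    unfolding A_def by (simp only: atLeastLessThanSuc_atLeastAtMost)
  have "spp F \<mu> \<xi> x0 (Suc k) \<in> borel_measurable N"
    by (rule spp_measurable[OF assms(8,9,5)])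
  then have meas: "?D \<in> borel_measurable N"
    by (rule measurable_compose) (intro borel_measurable_continuous_onI continuous_intros)
  have int: "integrable N ?D"
    using meas bound by (intro integrableI_nonneg) (auto intro: le_less_trans)
  have A: "0 \<le> A"
    unfolding A_def using \<mu>\<tau> S_nonneg \<beta>_nonneg
    by (intro add_nonneg_nonneg mult_nonneg_nonneg sum_nonneg prod_nonneg) auto
  show ?thesis
    using int integral_real_bounded[OF A bound] unfolding A_def by blast
qed

end
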